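(* If a program $P$ is typable in the stratified affine-intuitionistic type and effect system, i.e. $R;\Gamma\vdash P:(\alpha,e)$ is derivable for some $R,\Gamma,\alpha,e$, then every reduction sequence $P\to P_1\to P_2\to\cdots$ starting from $P$ is finite.
   Context: Syntax. Variables $x,y,\dots$. Values $V ::= * \mid x \mid \lambda x.M \mid\ !V$. Terms $M ::= V \mid MM \mid\ !M \mid \mathsf{let}\ !x = M\ \mathsf{in}\ M \mid \nu x\,M \mid \mathsf{set}(x,V) \mid \mathsf{pset}(x,V) \mid \mathsf{get}(x) \mid (M\mid M)$. Stores $S ::= (x\leftarrow V) \mid (x \Leftarrow V) \mid (S\mid S)$ (volatile resp. persistent store items). Programs $P ::= M \mid S \mid (P\mid P) \mid \nu x\,P$. The binders $\lambda x$, $\nu x$, $\mathsf{let}\ !x$ bind $x$. Evaluation contexts $E ::= [\,] \mid EM \mid VE \mid\ !E \mid \mathsf{let}\ !x = E\ \mathsf{in}\ M$; static contexts $C ::= [\,] \mid (C\mid P)\mid (P\mid C)\mid \nu x\,C$. Structural equivalence $\equiv$ is the least equivalence on programs closed under static contexts and containing $\alpha$-renaming, $P\mid P'\equiv P'\mid P$, $(P\mid P')\mid P''\equiv P\mid(P'\mid P'')$, $(\nu x\,P)\mid P'\equiv \nu x(P\mid P')$ if $x\notin FV(P')$, and $E[\nu x\,M]\equiv \nu x\,E[M]$ if $x\notin FV(E)$. Reduction: $P\to P'$ iff $P\equiv C[\Delta]$ and $P'\equiv C[\Delta']$ for some static context $C$ and basic step among: $E[(\lambda x.M)V]\to E[[V/x]M]$;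 $E[\mathsf{let}\ !x=\,!V\ \mathsf{in}\ M]\to E[[V/x]M]$; $E[\mathsf{set}(x,V)]\to E[*]\mid(x\leftarrow V)$; $E[\mathsf{pset}(x,V)]\to E[*]\mid(x\Leftarrow V)$; $E[\mathsf{get}(x)]\mid(x\leftarrow V)\to E[V]$; $E[\mathsf{get}(x)]\mid(x\Leftarrow\, !V)\to E[!V]\mid(x\Leftarrow\, !V)$. Types and effects. Regions $r,r',\dots$ are each volatile or persistent; an effect $e$ is a finite set of regions. Types $\alpha ::= \mathbf{B}\mid A$, value-types $A ::= \mathbf{1}\mid A\multimap^{e}\alpha \mid\ !A\mid \mathrm{Reg}_r A$. Usages: on $\{0,1,\infty\}$ the partial sum $\uplus$ has $a\uplus 0=0\uplus a=a$, $\infty\uplus\infty=\infty$, undefined otherwise. A context is $\Gamma = x_1:(u_1,A_1),\dots,x_n:(u_n,A_n)$, distinct $x_i$, $u_i\in\{1,\infty\}$. A region usage $U=(v,v')$ (output, input) lies in one of $\{(\infty,\infty)\}$, $\{(1,\infty),(0,\infty)\}$, $\{(0,0),(1,0),(0,1),(1,1)\}$; $U_1\uplus U_2$ is defined iff both lie in the same set and the componentwise sum is defined. A region context is an ordered list $R=r_1:(U_1,A_1),\dots,r_n:(U_n,A_n)$ with distinct $r_i$. Sums of contexts and region contexts are componentwise (domains of region contexts implicitly equalized with neutral usages $(\infty,\infty)$, $(0,\infty)$, $(0,0)$). Stratified formation rules: $\emptyset\vdash$; if $R\vdash A$ and $r\notin\mathrm{dom}(R)$ then $R,r:(U,A)\vdash$;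 if $R\vdash$ then $R\vdash\mathbf{1}$ and $R\vdash\mathbf{B}$; if $R\vdash A$ then $R\vdash\, !A$; if $R\vdash A$, $R\vdash\alpha$, $e\subseteq\mathrm{dom}(R)$ then $R\vdash A\multimap^e\alpha$; if $R\vdash$ and $r:(U,A)\in R$ then $R\vdash\mathrm{Reg}_rA$; if $R\vdash\alpha$ and $e\subseteq\mathrm{dom}(R)$ then $R\vdash(\alpha,e)$; $R\vdash\Gamma$ iff $R\vdash A$ for all $x:(u,A)\in\Gamma$. (Thus a value stored in region $r$ can only have latent effects on regions declared before $r$.) $\mathrm{aff}(x:(u,A))$ iff $u=1$; $\mathrm{aff}(r:((v,v'),A))$ iff $1\in\{v,v'\}$ or ($r$ volatile and $v'\neq 0$); $\mathrm{aff}(R;\Gamma)$: some hypothesis satisfies $\mathrm{aff}$; $\mathrm{saff}(R;\Gamma)$: all do. Subtyping: $R\vdash\alpha\le\alpha$; $R\vdash A\le A'$ gives $R\vdash\, !A\le\, !A'$; $e\subseteq e'\subseteq\mathrm{dom}(R)$, $R\vdash A'\le A$, $R\vdash\alpha\le\alpha'$ give $R\vdash (A\multimap^e\alpha)\le(A'\multimap^{e'}\alpha')$; $e\subseteq e'\subseteq\mathrm{dom}(R)$, $R\vdash\alpha\le\alpha'$ give $R\vdash(\alpha,e)\le(\alpha',e')$. Typing rules for $R;\Gamma\vdash P:(\alpha,e)$ (all well-formedness premises understood with the stratified rules): (sub) from $R;\Gamma\vdash M:(\alpha,e)$ and $R\vdash(\alpha,e)\le(\alpha',e')$ infer $R;\Gamma\vdash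 M:(\alpha',e')$. (var) $R\vdash\Gamma$, $x:(u,A)\in\Gamma$ give $x:(A,\emptyset)$. (unit) $R\vdash\Gamma$ gives $*:(\mathbf{1},\emptyset)$. (abs) $R;\Gamma,x:(1,A)\vdash M:(\alpha,e)$ gives $R;\Gamma\vdash\lambda x.M:(A\multimap^e\alpha,\emptyset)$. (app) $R_1;\Gamma_1\vdash M:(A\multimap^e\alpha,e')$, $R_2;\Gamma_2\vdash N:(A,e'')$ give $R_1\uplus R_2;\Gamma_1\uplus\Gamma_2\vdash MN:(\alpha,e\cup e'\cup e'')$. (prom) $R\uplus R'\vdash\Gamma\uplus\Gamma'$, $\mathrm{saff}(R';\Gamma')$, $R;\Gamma\vdash M:(A,e)$, $\neg\mathrm{aff}(R;\Gamma)$ give $R\uplus R';\Gamma\uplus\Gamma'\vdash\, !M:(!A,e)$. (let) $R_1;\Gamma_1\vdash M:(!A,e)$, $R_2;\Gamma_2,x:(\infty,A)\vdash N:(\alpha,e')$ give $R_1\uplus R_2;\Gamma_1\uplus\Gamma_2\vdash\mathsf{let}\ !x=M\ \mathsf{in}\ N:(\alpha,e\cup e')$. (new) $R;\Gamma,x:(u,\mathrm{Reg}_rA)\vdash P:(\alpha,e)$ gives $R;\Gamma\vdash\nu x\,P:(\alpha,e)$. (get) $R\vdash\Gamma$, $x:(u,\mathrm{Reg}_rA)\in\Gamma$, $r:((v,v'),A)\in R$, $v'\neq0$ give $\mathsf{get}(x):(A,\{r\})$. (set) $\Gamma=x:(u,\mathrm{Reg}_rA)\uplus\Gamma'$, $r$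 volatile, $R=r:((v,v'),A)\uplus R'$, $v\neq0$, $R\vdash\Gamma$, $R';\Gamma'\vdash V:(A,\emptyset)$ give $R;\Gamma\vdash\mathsf{set}(x,V):(\mathbf{1},\{r\})$ and, with the same premises, $R;\Gamma\vdash(x\leftarrow V):(\mathbf{B},\emptyset)$. (pset) $\Gamma=x:(u,\mathrm{Reg}_r!A)\uplus\Gamma'$, $r$ persistent, $R=r:((v,v'),!A)\uplus R'$, $v\neq0$, $R\vdash\Gamma$, $R';\Gamma'\vdash V:(!A,\emptyset)$ give $R;\Gamma\vdash\mathsf{pset}(x,V):(\mathbf{1},\{r\})$ and, with the same premises, $R;\Gamma\vdash(x\Leftarrow V):(\mathbf{B},\emptyset)$. (par-store) $R_1;\Gamma_1\vdash P:(\alpha,e)$, $R_2;\Gamma_2\vdash S:(\mathbf{B},\emptyset)$ with $S$ a store give $R_1\uplus R_2;\Gamma_1\uplus\Gamma_2\vdash(P\mid S):(\alpha,e)$, likewise $(S\mid P)$. (par) $R_i;\Gamma_i\vdash P_i:(\alpha_i,e_i)$, $P_i$ not a store ($i=1,2$) give $R_1\uplus R_2;\Gamma_1\uplus\Gamma_2\vdash(P_1\mid P_2):(\mathbf{B},e_1\cup e_2)$. *)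

theory Defs
  imports Main
begin

type_synonym var = nat

text \<open>One datatype for values, terms, stores and programs; the syntactic
categories are carved out by the predicates below.  The first argument of
set/pset/get and of store items is a term which, in well-formed syntax, must be a
variable (this keeps substitution total and uniform).\<close>

datatype tm =
    Unit
  | Var var
  | Lam var tm
  | Bang tm
  | App tm tm
  | Let var tm tm       \<comment> \<open>let !x = M in N\<close>
  | Nu var tm
  | SetT tm tm
  | PSetT tm tm
  | Get tm
  | Par tm tm
  | StV tm tm           \<comment> \<open>volatile store item (x <- V)\<close>
  | StP tm tm           \<comment> \<open>persistent store item (x <= V)\<close>

fun is_var :: "tm \<Rightarrow> bool" where
  "is_var (Var x) = True"
| "is_var _ = False"

fun is_value :: "tm \<Rightarrow> bool" and is_term :: "tm \<Rightarrow> bool" where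
  "is_value Unit = True"
| "is_value (Var x) = True"
| "is_value (Lam x M) = is_term M"
| "is_value (Bang V) = is_value V"
| "is_value (App M N) = False"
| "is_value (Let x M N) = False"
| "is_value (Nu x M) = False"
| "is_value (SetT a V) = False"
| "is_value (PSetT a V) = False"
| "is_value (Get a) = False"
| "is_value (Par M N) = False"
| "is_value (StV a V) = False"
| "is_value (StP a V) = False"
| "is_term Unit = True"
| "is_term (Var x) = True"
| "is_term (Lam x M) = is_term M"
| "is_term (Bang M) = is_term M"
| "is_term (App M N) = (is_term M \<and> is_term N)"
| "is_term (Let x M N) = (is_term M \<and> is_term N)"
| "is_term (Nu x M) = is_term M"
| "is_term (SetT a V) = (is_var a \<and> is_value V)"
| "is_term (PSetT a V) = (is_var a \<and> is_value V)"
| "is_term (Get a) = is_var a"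
| "is_term (Par M N) = (is_term M \<and> is_term N)"
| "is_term (StV a V) = False"
| "is_term (StP a V) = False"

fun is_store :: "tm \<Rightarrow> bool" where
  "is_store (StV a V) = (is_var a \<and> is_value V)"
| "is_store (StP a V) = (is_var a \<and> is_value V)"
| "is_store (Par S T) = (is_store S \<and> is_store T)"
| "is_store _ = False"

fun is_prog :: "tm \<Rightarrow> bool" where
  "is_prog (Par P Q) = (is_prog P \<and> is_prog Q)"
| "is_prog (Nu x P) = is_prog P"
| "is_prog t = (is_term t \<or> is_store t)"

fun fv :: "tm \<Rightarrow> var set" where
  "fv Unit = {}"
| "fv (Var x) = {x}"
| "fv (Lam x M) = fv M - {x}"
| "fv (Bang M) = fv M"
| "fv (App M N) = fv M \<union> fv N"
| "fv (Let x M N) = fv M \<union> (fv N - {x})"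
| "fv (Nu x M) = fv M - {x}"
| "fv (SetT a V) = fv a \<union> fv V"
| "fv (PSetT a V) = fv a \<union> fv V"
| "fv (Get a) = fv a"
| "fv (Par M N) = fv M \<union> fv N"
| "fv (StV a V) = fv a \<union> fv V"
| "fv (StP a V) = fv a \<union> fv V"

fun bv :: "tm \<Rightarrow> var set" where
  "bv Unit = {}"
| "bv (Var x) = {}"
| "bv (Lam x M) = insert x (bv M)"
| "bv (Bang M) = bv M"
| "bv (App M N) = bv M \<union> bv N"
| "bv (Let x M N) = insert x (bv M \<union> bv N)"
| "bv (Nu x M) = insert x (bv M)"
| "bv (SetT a V) = bv a \<union> bv V"
| "bv (PSetT a V) = bv a \<union> bv V"
| "bv (Get a) = bv a"
| "bv (Par M N) = bv M \<union> bv N"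
| "bv (StV a V) = bv a \<union> bv V"
| "bv (StP a V) = bv a \<union> bv V"

definition swapv :: "var \<Rightarrow> var \<Rightarrow> var \<Rightarrow> var" where
  "swapv a b z = (if z = a then b else if z = b then a else z)"

fun swap :: "var \<Rightarrow> var \<Rightarrow> tm \<Rightarrow> tm" where
  "swap a b Unit = Unit"
| "swap a b (Var x) = Var (swapv a b x)"
| "swap a b (Lam x M) = Lam (swapv a b x) (swap a b M)"
| "swap a b (Bang M) = Bang (swap a b M)"
| "swap a b (App M N) = App (swap a b M) (swap a b N)"
| "swap a b (Let x M N) = Let (swapv a b x) (swap a b M) (swap a b N)"
| "swap a b (Nu x M) = Nu (swapv a b x) (swap a b M)"
| "swap a b (SetT c V) = SetT (swap a b c) (swap a b V)"
| "swap a b (PSetT c V) = PSetT (swap a b c) (swap a b V)"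
| "swap a b (Get c) = Get (swap a b c)"
| "swap a b (Par M N) = Par (swap a b M) (swap a b N)"
| "swap a b (StV c V) = StV (swap a b c) (swap a b V)"
| "swap a b (StP c V) = StP (swap a b c) (swap a b V)"

inductive alpha :: "tm \<Rightarrow> tm \<Rightarrow> bool" where
  a_unit: "alpha Unit Unit"
| a_var: "alpha (Var x) (Var x)"
| a_lam1: "alpha M N \<Longrightarrow> alpha (Lam x M) (Lam x N)"
| a_lam2: "x \<noteq> y \<Longrightarrow> x \<notin> fv N \<Longrightarrow> alpha M (swap x y N) \<Longrightarrow> alpha (Lam x M) (Lam y N)"
| a_bang: "alpha M N \<Longrightarrow> alpha (Bang M) (Bang N)"
| a_app: "alpha M M' \<Longrightarrow> alpha N N' \<Longrightarrow> alpha (App M N) (App M' N')"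
| a_let1: "alpha M M' \<Longrightarrow> alpha N N' \<Longrightarrow> alpha (Let x M N) (Let x M' N')"
| a_let2: "x \<noteq> y \<Longrightarrow> x \<notin> fv N' \<Longrightarrow> alpha M M' \<Longrightarrow> alpha N (swap x y N')
           \<Longrightarrow> alpha (Let x M N) (Let y M' N')"
| a_nu1: "alpha M N \<Longrightarrow> alpha (Nu x M) (Nu x N)"
| a_nu2: "x \<noteq> y \<Longrightarrow> x \<notin> fv N \<Longrightarrow> alpha M (swap x y N) \<Longrightarrow> alpha (Nu x M) (Nu y N)"
| a_set: "alpha a a' \<Longrightarrow> alpha V V' \<Longrightarrow> alpha (SetT a V) (SetT a' V')"
| a_pset: "alpha a a' \<Longrightarrow> alpha V V' \<Longrightarrow> alpha (PSetT a V) (PSetT a' V')"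
| a_get: "alpha a a' \<Longrightarrow> alpha (Get a) (Get a')"
| a_par: "alpha M M' \<Longrightarrow> alpha N N' \<Longrightarrow> alpha (Par M N) (Par M' N')"
| a_stv: "alpha a a' \<Longrightarrow> alpha V V' \<Longrightarrow> alpha (StV a V) (StV a' V')"
| a_stp: "alpha a a' \<Longrightarrow> alpha V V' \<Longrightarrow> alpha (StP a V) (StP a' V')"

text \<open>Substitution [V/x]M.  It is the naive substitution; the reduction rules
below only use it when no binder of M captures a free variable of V
(bv M \<inter> fv V = {}), which is always achievable by alpha-renaming, which is
part of structural equivalence.\<close>
fun subst :: "tm \<Rightarrow> var \<Rightarrow> tm \<Rightarrow> tm" where
  "subst V x Unit = Unit"
| "subst V x (Var y) = (if y = x then V else Var y)"
| "subst V x (Lam y M) = (if y = x then Lam y M else Lam y (subst V x M))"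
| "subst V x (Bang M) = Bang (subst V x M)"
| "subst V x (App M N) = App (subst V x M) (subst V x N)"
| "subst V x (Let y M N) = Let y (subst V x M) (if y = x then N else subst V x N)"
| "subst V x (Nu y M) = (if y = x then Nu y M else Nu y (subst V x M))"
| "subst V x (SetT a W) = SetT (subst V x a) (subst V x W)"
| "subst V x (PSetT a W) = PSetT (subst V x a) (subst V x W)"
| "subst V x (Get a) = Get (subst V x a)"
| "subst V x (Par M N) = Par (subst V x M) (subst V x N)"
| "subst V x (StV a W) = StV (subst V x a) (subst V x W)"
| "subst V x (StP a W) = StP (subst V x a) (subst V x W)"

datatype ectx = EHole | EAppL ectx tm | EAppR tm ectx | EBang ectx | ELet var ectx tm

fun efill :: "ectx \<Rightarrow> tm \<Rightarrow> tm" where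
  "efill EHole t = t"
| "efill (EAppL E M) t = App (efill E t) M"
| "efill (EAppR V E) t = App V (efill E t)"
| "efill (EBang E) t = Bang (efill E t)"
| "efill (ELet x E M) t = Let x (efill E t) M"

fun wf_ectx :: "ectx \<Rightarrow> bool" where
  "wf_ectx EHole = True"
| "wf_ectx (EAppL E M) = (wf_ectx E \<and> is_term M)"
| "wf_ectx (EAppR V E) = (is_value V \<and> wf_ectx E)"
| "wf_ectx (EBang E) = wf_ectx E"
| "wf_ectx (ELet x E M) = (wf_ectx E \<and> is_term M)"

fun fv_ectx :: "ectx \<Rightarrow> var set" where
  "fv_ectx EHole = {}"
| "fv_ectx (EAppL E M) = fv_ectx E \<union> fv M"
| "fv_ectx (EAppR V E) = fv V \<union> fv_ectx E"
| "fv_ectx (EBang E) = fv_ectx E"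
| "fv_ectx (ELet x E M) = fv_ectx E \<union> (fv M - {x})"

datatype sctx = SHole | SParL sctx tm | SParR tm sctx | SNu var sctx

fun sfill :: "sctx \<Rightarrow> tm \<Rightarrow> tm" where
  "sfill SHole t = t"
| "sfill (SParL C P) t = Par (sfill C t) P"
| "sfill (SParR P C) t = Par P (sfill C t)"
| "sfill (SNu x C) t = Nu x (sfill C t)"

fun wf_sctx :: "sctx \<Rightarrow> bool" where
  "wf_sctx SHole = True"
| "wf_sctx (SParL C P) = (wf_sctx C \<and> is_prog P)"
| "wf_sctx (SParR P C) = (is_prog P \<and> wf_sctx C)"
| "wf_sctx (SNu x C) = wf_sctx C"

inductive sequiv :: "tm \<Rightarrow> tm \<Rightarrow> bool" where
  s_refl: "is_prog P \<Longrightarrow> sequiv P P"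
| s_sym: "sequiv P Q \<Longrightarrow> sequiv Q P"
| s_trans: "sequiv P Q \<Longrightarrow> sequiv Q R \<Longrightarrow> sequiv P R"
| s_alpha: "is_prog P \<Longrightarrow> alpha P Q \<Longrightarrow> sequiv P Q"
| s_comm: "is_prog P \<Longrightarrow> is_prog Q \<Longrightarrow> sequiv (Par P Q) (Par Q P)"
| s_assoc: "is_prog P \<Longrightarrow> is_prog Q \<Longrightarrow> is_prog R \<Longrightarrow>
            sequiv (Par (Par P Q) R) (Par P (Par Q R))"
| s_extr: "is_prog P \<Longrightarrow> is_prog Q \<Longrightarrow> x \<notin> fv Q \<Longrightarrow>
            sequiv (Par (Nu x P) Q) (Nu x (Par P Q))"
| s_enu: "wf_ectx E \<Longrightarrow> is_term M \<Longrightarrow> x \<notin> fv_ectx E \<Longrightarrow>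
            sequiv (efill E (Nu x M)) (Nu x (efill E M))"
| s_parL: "sequiv P P' \<Longrightarrow> is_prog Q \<Longrightarrow> sequiv (Par P Q) (Par P' Q)"
| s_parR: "sequiv P P' \<Longrightarrow> is_prog Q \<Longrightarrow> sequiv (Par Q P) (Par Q P')"
| s_nu: "sequiv P P' \<Longrightarrow> sequiv (Nu x P) (Nu x P')"

inductive basic :: "tm \<Rightarrow> tm \<Rightarrow> bool" where
  b_beta: "wf_ectx E \<Longrightarrow> is_term M \<Longrightarrow> is_value V \<Longrightarrow> bv M \<inter> fv V = {} \<Longrightarrow>
     basic (efill E (App (Lam x M) V)) (efill E (subst V x M))"
| b_let: "wf_ectx E \<Longrightarrow> is_term M \<Longrightarrow> is_value V \<Longrightarrow> bv M \<inter> fv V = {} \<Longrightarrow>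
     basic (efill E (Let x (Bang V) M)) (efill E (subst V x M))"
| b_set: "wf_ectx E \<Longrightarrow> is_value V \<Longrightarrow>
     basic (efill E (SetT (Var x) V)) (Par (efill E Unit) (StV (Var x) V))"
| b_pset: "wf_ectx E \<Longrightarrow> is_value V \<Longrightarrow>
     basic (efill E (PSetT (Var x) V)) (Par (efill E Unit) (StP (Var x) V))"
| b_get: "wf_ectx E \<Longrightarrow> is_value V \<Longrightarrow>
     basic (Par (efill E (Get (Var x))) (StV (Var x) V)) (efill E V)"
| b_pget: "wf_ectx E \<Longrightarrow> is_value V \<Longrightarrow>
     basic (Par (efill E (Get (Var x))) (StP (Var x) (Bang V)))
           (Par (efill E (Bang V)) (StP (Var x) (Bang V)))"

definition red :: "tm \<Rightarrow> tm \<Rightarrow> bool" where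
  "red P P' \<longleftrightarrow> (\<exists>C D D'. wf_sctx C \<and> basic D D' \<and>
                   sequiv P (sfill C D) \<and> sequiv P' (sfill C D'))"

definition terminating :: "tm \<Rightarrow> bool" where
  "terminating P \<longleftrightarrow> \<not> (\<exists>f. f 0 = P \<and> (\<forall>i. red (f i) (f (Suc i))))"

datatype rkind = Volatile | Persistent

type_synonym reg = "nat \<times> rkind"

definition volatile :: "reg \<Rightarrow> bool" where "volatile r \<longleftrightarrow> snd r = Volatile"
definition persistent :: "reg \<Rightarrow> bool" where "persistent r \<longleftrightarrow> snd r = Persistent"

datatype vty = TOne | TArr vty "reg set" ty | TBang vty | TReg reg vty
     and ty = TB | TV vty

datatype use = U0 | U1 | UInf

fun usum :: "use \<Rightarrow> use \<Rightarrow> use option" where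
  "usum a U0 = Some a"
| "usum U0 a = Some a"
| "usum UInf UInf = Some UInf"
| "usum _ _ = None"

type_synonym ruse = "use \<times> use"

text \<open>Class of a region usage (None if not a legal region usage).\<close>
definition rclass :: "ruse \<Rightarrow> nat option" where
  "rclass U = (if U = (UInf, UInf) then Some 1
               else if U \<in> {(U1, UInf), (U0, UInf)} then Some 2
               else if U \<in> {(U0,U0), (U1,U0), (U0,U1), (U1,U1)} then Some 3
               else None)"

definition rusum :: "ruse \<Rightarrow> ruse \<Rightarrow> ruse option" where
  "rusum U V = (if rclass U \<noteq> None \<and> rclass U = rclass V then
                  (case (usum (fst U) (fst V), usum (snd U) (snd V)) of
                     (Some a, Some b) \<Rightarrow> Some (a, b) | _ \<Rightarrow> None)
                else None)"

definition neutral :: "ruse \<Rightarrow> bool" where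
  "neutral U \<longleftrightarrow> U \<in> {(UInf, UInf), (U0, UInf), (U0, U0)}"

type_synonym ctx = "var \<Rightarrow> (use \<times> vty) option"

type_synonym rctx = "(reg \<times> ruse \<times> vty) list"

definition rdom :: "rctx \<Rightarrow> reg set" where "rdom R = set (map fst R)"

definition csum :: "ctx \<Rightarrow> ctx \<Rightarrow> ctx \<Rightarrow> bool" where
  "csum G1 G2 G \<longleftrightarrow> (\<forall>x. case (G1 x, G2 x) of
      (None, None) \<Rightarrow> G x = None
    | (Some a, None) \<Rightarrow> G x = Some a
    | (None, Some b) \<Rightarrow> G x = Some b
    | (Some (u1, A1), Some (u2, A2)) \<Rightarrow>
        A1 = A2 \<and> (\<exists>u. usum u1 u2 = Some u \<and> G x = Some (u, A1)))"

text \<open>R' is R with some entries of neutral usage inserted (domain equalization).\<close>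
inductive rext :: "rctx \<Rightarrow> rctx \<Rightarrow> bool" where
  "rext [] []"
| "rext R R' \<Longrightarrow> rext (a # R) (a # R')"
| "rext R R' \<Longrightarrow> neutral U \<Longrightarrow> rext R ((r, U, A) # R')"

definition rsum :: "rctx \<Rightarrow> rctx \<Rightarrow> rctx \<Rightarrow> bool" where
  "rsum R1 R2 R \<longleftrightarrow> distinct (map fst R) \<and>
     (\<exists>R1' R2'. rext R1 R1' \<and> rext R2 R2' \<and>
        length R1' = length R \<and> length R2' = length R \<and>
        (\<forall>i < length R. case (R1' ! i, R2' ! i, R ! i) of ((r1, W1, A1), (r2, W2, A2), (r, W, A)) \<Rightarrow>
            r1 = r \<and> r2 = r \<and> A1 = A \<and> A2 = A \<and> rusum W1 W2 = Some W))"

inductive wfR :: "rctx \<Rightarrow> bool" and wfV :: "rctx \<Rightarrow> vty \<Rightarrow> bool" and wfT :: "rctx \<Rightarrow> ty \<Rightarrow> bool"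
where
  wf_nil: "wfR []"
| wf_snoc: "wfV R A \<Longrightarrow> r \<notin> rdom R \<Longrightarrow> rclass U \<noteq> None \<Longrightarrow> wfR (R @ [(r, U, A)])"
| wf_one: "wfR R \<Longrightarrow> wfV R TOne"
| wf_B: "wfR R \<Longrightarrow> wfT R TB"
| wf_bang: "wfV R A \<Longrightarrow> wfV R (TBang A)"
| wf_arr: "wfV R A \<Longrightarrow> wfT R \<alpha> \<Longrightarrow> e \<subseteq> rdom R \<Longrightarrow> wfV R (TArr A e \<alpha>)"
| wf_reg: "wfR R \<Longrightarrow> (r, U, A) \<in> set R \<Longrightarrow> wfV R (TReg r A)"
| wf_lift: "wfV R A \<Longrightarrow> wfT R (TV A)"

definition wfG :: "rctx \<Rightarrow> ctx \<Rightarrow> bool" where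
  "wfG R G \<longleftrightarrow> wfR R \<and> finite (dom G) \<and>
     (\<forall>x u A. G x = Some (u, A) \<longrightarrow> u \<noteq> U0 \<and> wfV R A)"

definition raff :: "reg \<times> ruse \<times> vty \<Rightarrow> bool" where
  "raff h = (case h of (r, (v, v'), A) \<Rightarrow> v = U1 \<or> v' = U1 \<or> (volatile r \<and> v' \<noteq> U0))"

definition aff :: "rctx \<Rightarrow> ctx \<Rightarrow> bool" where
  "aff R G \<longleftrightarrow> (\<exists>h \<in> set R. raff h) \<or> (\<exists>x A. G x = Some (U1, A))"

definition saff :: "rctx \<Rightarrow> ctx \<Rightarrow> bool" where
  "saff R G \<longleftrightarrow> (\<forall>h \<in> set R. raff h) \<and> (\<forall>x u A. G x = Some (u, A) \<longrightarrow> u = U1)"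

inductive subV :: "rctx \<Rightarrow> vty \<Rightarrow> vty \<Rightarrow> bool" and subT :: "rctx \<Rightarrow> ty \<Rightarrow> ty \<Rightarrow> bool"
where
  subV_refl: "subV R A A"
| subT_refl: "subT R \<alpha> \<alpha>"
| subV_bang: "subV R A A' \<Longrightarrow> subV R (TBang A) (TBang A')"
| subV_arr: "e \<subseteq> e' \<Longrightarrow> e' \<subseteq> rdom R \<Longrightarrow> subV R A' A \<Longrightarrow> subT R \<alpha> \<alpha>' \<Longrightarrow>
      subV R (TArr A e \<alpha>) (TArr A' e' \<alpha>')"
| subT_lift: "subV R A A' \<Longrightarrow> subT R (TV A) (TV A')"

definition subE :: "rctx \<Rightarrow> ty \<Rightarrow> reg set \<Rightarrow> ty \<Rightarrow> reg set \<Rightarrow> bool" where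
  "subE R \<alpha> e \<alpha>' e' \<longleftrightarrow> e \<subseteq> e' \<and> e' \<subseteq> rdom R \<and> subT R \<alpha> \<alpha>'"

inductive typing :: "rctx \<Rightarrow> ctx \<Rightarrow> tm \<Rightarrow> ty \<Rightarrow> reg set \<Rightarrow> bool" where
  t_sub: "typing R G M \<alpha> e \<Longrightarrow> is_term M \<Longrightarrow> subE R \<alpha> e \<alpha>' e' \<Longrightarrow> typing R G M \<alpha>' e'"
| t_var: "wfG R G \<Longrightarrow> G x = Some (u, A) \<Longrightarrow> typing R G (Var x) (TV A) {}"
| t_unit: "wfG R G \<Longrightarrow> typing R G Unit (TV TOne) {}"
| t_abs: "x \<notin> dom G \<Longrightarrow> typing R (G(x \<mapsto> (U1, A))) M \<alpha> e \<Longrightarrow>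
      typing R G (Lam x M) (TV (TArr A e \<alpha>)) {}"
| t_app: "typing R1 G1 M (TV (TArr A e \<alpha>)) e' \<Longrightarrow> typing R2 G2 N (TV A) e'' \<Longrightarrow>
      rsum R1 R2 R \<Longrightarrow> csum G1 G2 G \<Longrightarrow> typing R G (App M N) \<alpha> (e \<union> e' \<union> e'')"
| t_prom: "rsum R R' R0 \<Longrightarrow> csum G G' G0 \<Longrightarrow> wfG R0 G0 \<Longrightarrow> saff R' G' \<Longrightarrow>
      typing R G M (TV A) e \<Longrightarrow> \<not> aff R G \<Longrightarrow> typing R0 G0 (Bang M) (TV (TBang A)) e"
| t_let: "typing R1 G1 M (TV (TBang A)) e \<Longrightarrow> x \<notin> dom G2 \<Longrightarrow>
      typing R2 (G2(x \<mapsto> (UInf, A))) N \<alpha> e' \<Longrightarrow>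
      rsum R1 R2 R \<Longrightarrow> csum G1 G2 G \<Longrightarrow> typing R G (Let x M N) \<alpha> (e \<union> e')"
| t_new: "x \<notin> dom G \<Longrightarrow> u \<noteq> U0 \<Longrightarrow> typing R (G(x \<mapsto> (u, TReg r A))) P \<alpha> e \<Longrightarrow>
      typing R G (Nu x P) \<alpha> e"
| t_get: "wfG R G \<Longrightarrow> G x = Some (u, TReg r A) \<Longrightarrow> (r, (v, v'), A) \<in> set R \<Longrightarrow> v' \<noteq> U0 \<Longrightarrow>
      typing R G (Get (Var x)) (TV A) {r}"
| t_set: "csum [x \<mapsto> (u, TReg r A)] G' G \<Longrightarrow> u \<noteq> U0 \<Longrightarrow> volatile r \<Longrightarrow>
      rsum [(r, (v, v'), A)] R' R \<Longrightarrow> v \<noteq> U0 \<Longrightarrow> wfG R G \<Longrightarrow> is_value V \<Longrightarrow>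
      typing R' G' V (TV A) {} \<Longrightarrow> typing R G (SetT (Var x) V) (TV TOne) {r}"
| t_store: "csum [x \<mapsto> (u, TReg r A)] G' G \<Longrightarrow> u \<noteq> U0 \<Longrightarrow> volatile r \<Longrightarrow>
      rsum [(r, (v, v'), A)] R' R \<Longrightarrow> v \<noteq> U0 \<Longrightarrow> wfG R G \<Longrightarrow> is_value V \<Longrightarrow>
      typing R' G' V (TV A) {} \<Longrightarrow> typing R G (StV (Var x) V) TB {}"
| t_pset: "csum [x \<mapsto> (u, TReg r (TBang A))] G' G \<Longrightarrow> u \<noteq> U0 \<Longrightarrow> persistent r \<Longrightarrow>
      rsum [(r, (v, v'), TBang A)] R' R \<Longrightarrow> v \<noteq> U0 \<Longrightarrow> wfG R G \<Longrightarrow> is_value V \<Longrightarrow>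
      typing R' G' V (TV (TBang A)) {} \<Longrightarrow> typing R G (PSetT (Var x) V) (TV TOne) {r}"
| t_pstore: "csum [x \<mapsto> (u, TReg r (TBang A))] G' G \<Longrightarrow> u \<noteq> U0 \<Longrightarrow> persistent r \<Longrightarrow>
      rsum [(r, (v, v'), TBang A)] R' R \<Longrightarrow> v \<noteq> U0 \<Longrightarrow> wfG R G \<Longrightarrow> is_value V \<Longrightarrow>
      typing R' G' V (TV (TBang A)) {} \<Longrightarrow> typing R G (StP (Var x) V) TB {}"
| t_par_store1: "typing R1 G1 P \<alpha> e \<Longrightarrow> typing R2 G2 S TB {} \<Longrightarrow> is_store S \<Longrightarrow>
      rsum R1 R2 R \<Longrightarrow> csum G1 G2 G \<Longrightarrow> typing R G (Par P S) \<alpha> e"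
| t_par_store2: "typing R1 G1 P \<alpha> e \<Longrightarrow> typing R2 G2 S TB {} \<Longrightarrow> is_store S \<Longrightarrow>
      rsum R2 R1 R \<Longrightarrow> csum G2 G1 G \<Longrightarrow> typing R G (Par S P) \<alpha> e"
| t_par: "typing R1 G1 P1 \<alpha>1 e1 \<Longrightarrow> typing R2 G2 P2 \<alpha>2 e2 \<Longrightarrow> \<not> is_store P1 \<Longrightarrow> \<not> is_store P2 \<Longrightarrow>
      rsum R1 R2 R \<Longrightarrow> csum G1 G2 G \<Longrightarrow> typing R G (Par P1 P2) TB (e1 \<union> e2)"

end

(* Reducibility candidates that never look at the store.  A program is erased to de Bruijn
   terms in which every name bound by nu is replaced by (a guess of) its region, so that nu, and
   with it scope extrusion, disappears; structural equivalence becomes equality of the multisets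
   of parallel threads.  A read from region r is allowed to return any value of a fixed set I r
   and a write must store an element of I r, so each thread can be treated in isolation.
   Stratification makes it possible to choose I with I r = interpretation of the type stored in
   r: that type only mentions effects on earlier regions, and the interpretation of an arrow with
   latent effect e depends on I only at e, hence I can be built region by region.  Usages play no
   role.  Every typable program then erases to a multiset of accessible threads, and each
   reduction step replaces one thread by finitely many of its successors, which cannot go on
   forever by the multiset ordering. *)

theory Submission
  imports Defs "HOL-Library.Multiset" "HOL-Library.Sublist"
begin

text \<open>Typing is consulted only once, at the start of a run. It supplies an erasure with
  accessible threads, and accessibility is then the invariant of the run, in place of a subject
  reduction theorem. The erased system over-approximates the program: addresses of one region are
  identified, so a thread may receive values which the program could never give it, and it is this
  larger system that is shown to terminate. Interpreting a store of functions directly would be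
  circular, since a function in a region may itself read regions. Answering reads from fixed sets
  \<open>I r\<close> leaves a single equation per region, \<open>I r = ValV I A\<close>, to be
  solved. The region of a nu-bound name belongs to the derivation, not to the term. An erasure
  therefore fixes one region per nu, and the choice has to survive both copying of the nu by
  substitution and its motion by scope extrusion. This is why an erasure is a function of an
  environment: substitution and nu both become updates of that environment.\<close>

section \<open>Erased terms\<close>

datatype db =
    DUnit
  | DVar nat
  | DLoc reg
  | DLam db
  | DBang db
  | DApp db db
  | DLet db db
  | DSet db db
  | DGet db
  | DPar db db
  | DSt db db

fun upren :: "(nat \<Rightarrow> nat) \<Rightarrow> nat \<Rightarrow> nat" where
  "upren \<xi> 0 = 0"
| "upren \<xi> (Suc n) = Suc (\<xi> n)"

primrec ren :: "(nat \<Rightarrow> nat) \<Rightarrow> db \<Rightarrow> db" where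
  "ren \<xi> DUnit = DUnit"
| "ren \<xi> (DVar n) = DVar (\<xi> n)"
| "ren \<xi> (DLoc r) = DLoc r"
| "ren \<xi> (DLam t) = DLam (ren (upren \<xi>) t)"
| "ren \<xi> (DBang t) = DBang (ren \<xi> t)"
| "ren \<xi> (DApp t u) = DApp (ren \<xi> t) (ren \<xi> u)"
| "ren \<xi> (DLet t u) = DLet (ren \<xi> t) (ren (upren \<xi>) u)"
| "ren \<xi> (DSet t u) = DSet (ren \<xi> t) (ren \<xi> u)"
| "ren \<xi> (DGet t) = DGet (ren \<xi> t)"
| "ren \<xi> (DPar t u) = DPar (ren \<xi> t) (ren \<xi> u)"
| "ren \<xi> (DSt t u) = DSt (ren \<xi> t) (ren \<xi> u)"

fun upsub :: "(nat \<Rightarrow> db) \<Rightarrow> nat \<Rightarrow> db" where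
  "upsub \<sigma> 0 = DVar 0"
| "upsub \<sigma> (Suc n) = ren Suc (\<sigma> n)"

primrec sub :: "(nat \<Rightarrow> db) \<Rightarrow> db \<Rightarrow> db" where
  "sub \<sigma> DUnit = DUnit"
| "sub \<sigma> (DVar n) = \<sigma> n"
| "sub \<sigma> (DLoc r) = DLoc r"
| "sub \<sigma> (DLam t) = DLam (sub (upsub \<sigma>) t)"
| "sub \<sigma> (DBang t) = DBang (sub \<sigma> t)"
| "sub \<sigma> (DApp t u) = DApp (sub \<sigma> t) (sub \<sigma> u)"
| "sub \<sigma> (DLet t u) = DLet (sub \<sigma> t) (sub (upsub \<sigma>) u)"
| "sub \<sigma> (DSet t u) = DSet (sub \<sigma> t) (sub \<sigma> u)"
| "sub \<sigma> (DGet t) = DGet (sub \<sigma> t)"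
| "sub \<sigma> (DPar t u) = DPar (sub \<sigma> t) (sub \<sigma> u)"
| "sub \<sigma> (DSt t u) = DSt (sub \<sigma> t) (sub \<sigma> u)"

fun scons :: "db \<Rightarrow> nat \<Rightarrow> db" where
  "scons v 0 = v"
| "scons v (Suc n) = DVar n"

abbreviation inst :: "db \<Rightarrow> db \<Rightarrow> db" where
  "inst v t \<equiv> sub (scons v) t"

section \<open>Laws of renaming and substitution for de Bruijn terms\<close>

lemma upren_comp: "upren \<xi> \<circ> upren \<zeta> = upren (\<xi> \<circ> \<zeta>)"
proof
  show "(upren \<xi> \<circ> upren \<zeta>) n = upren (\<xi> \<circ> \<zeta>) n" for n by (cases n) auto
qed

lemma ren_ren: "ren \<xi> (ren \<zeta> t) = ren (\<xi> \<circ> \<zeta>) t"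
  by (induction t arbitrary: \<xi> \<zeta>) (simp_all add: upren_comp[symmetric])

lemma upsub_comp_upren: "upsub \<sigma> \<circ> upren \<xi> = upsub (\<sigma> \<circ> \<xi>)"
proof
  show "(upsub \<sigma> \<circ> upren \<xi>) n = upsub (\<sigma> \<circ> \<xi>) n" for n by (cases n) auto
qed

lemma sub_ren: "sub \<sigma> (ren \<xi> t) = sub (\<sigma> \<circ> \<xi>) t"
  by (induction t arbitrary: \<sigma> \<xi>) (auto simp: upsub_comp_upren)

lemma upren_comp_upsub: "ren (upren \<xi>) \<circ> upsub \<sigma> = upsub (ren \<xi> \<circ> \<sigma>)"
proof
  show "(ren (upren \<xi>) \<circ> upsub \<sigma>) n = upsub (ren \<xi> \<circ> \<sigma>) n" for n
    by (cases n) (auto simp: ren_ren comp_def)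
qed

lemma ren_sub: "ren \<xi> (sub \<sigma> t) = sub (ren \<xi> \<circ> \<sigma>) t"
  by (induction t arbitrary: \<sigma> \<xi>) (auto simp: upren_comp_upsub)

lemma sub_DVar: "sub DVar t = t"
proof -
  have up: "upsub DVar = DVar"
  proof
    show "upsub DVar n = DVar n" for n by (cases n) auto
  qed
  show ?thesis by (induction t) (auto simp: up)
qed

lemma sub_upsub_ren_Suc: "sub (upsub \<sigma>) (ren Suc t) = ren Suc (sub \<sigma> t)"
  by (simp add: sub_ren ren_sub comp_def)

lemma ren_upren_ren_Suc: "ren (upren \<xi>) (ren Suc t) = ren Suc (ren \<xi> t)"
  by (simp add: ren_ren comp_def)

lemma inst_ren_Suc: "inst v (ren Suc t) = t"
proof -
  have "scons v \<circ> Suc = DVar" by auto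
  then show ?thesis by (simp add: sub_ren sub_DVar)
qed

fun isval :: "db \<Rightarrow> bool" where
  "isval DUnit = True"
| "isval (DVar n) = True"
| "isval (DLoc r) = True"
| "isval (DLam t) = True"
| "isval (DBang t) = isval t"
| "isval _ = False"

lemma isval_ren [simp]: "isval (ren \<xi> t) = isval t"
  by (induction t arbitrary: \<xi>) auto

section \<open>Erasure of names\<close>

type_synonym erasure = "(var \<Rightarrow> db) \<Rightarrow> db"

definition bind :: "var \<Rightarrow> (var \<Rightarrow> db) \<Rightarrow> var \<Rightarrow> db" where
  "bind x \<rho> = (\<lambda>y. if y = x then DVar 0 else ren Suc (\<rho> y))"

definition pw1 :: "(db \<Rightarrow> db) \<Rightarrow> erasure set \<Rightarrow> erasure set" where
  "pw1 c A = (\<lambda>f \<rho>. c (f \<rho>)) ` A"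

definition pw2 :: "(db \<Rightarrow> db \<Rightarrow> db) \<Rightarrow> erasure set \<Rightarrow> erasure set \<Rightarrow> erasure set" where
  "pw2 c A B = (\<Union>f\<in>A. (\<lambda>g \<rho>. c (f \<rho>) (g \<rho>)) ` B)"

definition scoped :: "var \<Rightarrow> erasure set \<Rightarrow> erasure set" where
  "scoped x A = (\<lambda>f \<rho>. f (bind x \<rho>)) ` A"

definition guess :: "var \<Rightarrow> erasure set \<Rightarrow> erasure set" where
  "guess x A = (\<Union>r. (\<lambda>f \<rho>. f (\<rho>(x := DLoc r))) ` A)"

text \<open>The argument of an erasure assigns erased terms to the free names.  The
erasure is a set because the region of a name bound by nu is not recorded in the term.\<close>
fun erase :: "tm \<Rightarrow> erasure set" where
  "erase Unit = {\<lambda>\<rho>. DUnit}"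
| "erase (Var x) = {\<lambda>\<rho>. \<rho> x}"
| "erase (Lam x M) = pw1 DLam (scoped x (erase M))"
| "erase (Bang M) = pw1 DBang (erase M)"
| "erase (App M N) = pw2 DApp (erase M) (erase N)"
| "erase (Let x M N) = pw2 DLet (erase M) (scoped x (erase N))"
| "erase (Nu x M) = guess x (erase M)"
| "erase (SetT a V) = pw2 DSet (erase a) (erase V)"
| "erase (PSetT a V) = pw2 DSet (erase a) (erase V)"
| "erase (Get a) = pw1 DGet (erase a)"
| "erase (Par M N) = pw2 DPar (erase M) (erase N)"
| "erase (StV a V) = pw2 DSt (erase a) (erase V)"
| "erase (StP a V) = pw2 DSt (erase a) (erase V)"

lemma pw1I: "f \<in> A \<Longrightarrow> (\<lambda>\<rho>. c (f \<rho>)) \<in> pw1 c A"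
  by (auto simp: pw1_def)

lemma pw2I: "f \<in> A \<Longrightarrow> g \<in> B \<Longrightarrow> (\<lambda>\<rho>. c (f \<rho>) (g \<rho>)) \<in> pw2 c A B"
  by (auto simp: pw2_def)

lemma scopedI: "f \<in> A \<Longrightarrow> (\<lambda>\<rho>. f (bind x \<rho>)) \<in> scoped x A"
  by (auto simp: scoped_def)

lemma guessI: "f \<in> A \<Longrightarrow> (\<lambda>\<rho>. f (\<rho>(x := DLoc r))) \<in> guess x A"
  unfolding guess_def by blast

lemma pw1E:
  assumes "h \<in> pw1 c A"
  obtains f where "f \<in> A" "h = (\<lambda>\<rho>. c (f \<rho>))"
  using assms by (auto simp: pw1_def)

lemma pw2E:
  assumes "h \<in> pw2 c A B"
  obtains f g where "f \<in> A" "g \<in> B" "h = (\<lambda>\<rho>. c (f \<rho>) (g \<rho>))"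
  using assms by (auto simp: pw2_def)

lemma scopedE:
  assumes "h \<in> scoped x A"
  obtains f where "f \<in> A" "h = (\<lambda>\<rho>. f (bind x \<rho>))"
  using assms by (auto simp: scoped_def)

lemma guessE:
  assumes "h \<in> guess x A"
  obtains f r where "f \<in> A" "h = (\<lambda>\<rho>. f (\<rho>(x := DLoc r)))"
  using assms by (auto simp: guess_def)

lemmas pw_intros = pw1I pw2I scopedI guessI
lemmas pw_elims = pw1E pw2E scopedE guessE

section \<open>Dependence of erasures on free names; naturality in the environment\<close>

definition supp :: "var set \<Rightarrow> erasure \<Rightarrow> bool" where
  "supp X f \<longleftrightarrow> (\<forall>\<rho> \<rho>'. (\<forall>x\<in>X. \<rho> x = \<rho>' x) \<longrightarrow> f \<rho> = f \<rho>')"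

lemma supp_pw1: "\<forall>f\<in>A. supp X f \<Longrightarrow> \<forall>f\<in>pw1 c A. supp X f"
  unfolding supp_def pw1_def by (auto intro!: arg_cong[where f = c])

lemma supp_pw2:
  assumes "\<forall>f\<in>A. supp X f" "\<forall>f\<in>B. supp Y f"
  shows "\<forall>f\<in>pw2 c A B. supp (X \<union> Y) f"
proof
  fix h assume "h \<in> pw2 c A B"
  then obtain f g where fg: "f \<in> A" "g \<in> B" "h = (\<lambda>\<rho>. c (f \<rho>) (g \<rho>))"
    by (rule pw2E)
  then have "f \<rho> = f \<rho>'" "g \<rho> = g \<rho>'" if "\<forall>x\<in>X \<union> Y. \<rho> x = \<rho>' x" for \<rho> \<rho>'
    using assms that unfolding supp_def by blast+
  then show "supp (X \<union> Y) h" unfolding supp_def fg by metis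
qed

lemma supp_scoped:
  assumes "\<forall>f\<in>A. supp X f"
  shows "\<forall>f\<in>scoped x A. supp (X - {x}) f"
proof
  fix h assume "h \<in> scoped x A"
  then obtain f where f: "f \<in> A" "h = (\<lambda>\<rho>. f (bind x \<rho>))"
    by (rule scopedE)
  have "\<forall>y\<in>X. bind x \<rho> y = bind x \<rho>' y" if "\<forall>y\<in>X - {x}. \<rho> y = \<rho>' y" for \<rho> \<rho>'
    using that by (auto simp: bind_def)
  then show "supp (X - {x}) h"
    using assms f unfolding supp_def f(2) by blast
qed

lemma supp_guess:
  assumes "\<forall>f\<in>A. supp X f"
  shows "\<forall>f\<in>guess x A. supp (X - {x}) f"
proof
  fix h assume "h \<in> guess x A"
  then obtain f r where f: "f \<in> A" "h = (\<lambda>\<rho>. f (\<rho>(x := DLoc r)))"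
    by (rule guessE)
  have "\<forall>y\<in>X. (\<rho>(x := DLoc r)) y = (\<rho>'(x := DLoc r)) y"
    if "\<forall>y\<in>X - {x}. \<rho> y = \<rho>' y" for \<rho> \<rho>'
    using that by auto
  then show "supp (X - {x}) h"
    using assms f unfolding supp_def f(2) by blast
qed

lemma erase_supp: "\<forall>f\<in>erase M. supp (fv M) f"
proof (induction M)
  case Unit
  show ?case by (simp add: supp_def)
next
  case (Var x)
  show ?case by (simp add: supp_def)
qed (unfold erase.simps fv.simps, (intro supp_pw1 supp_pw2 supp_scoped supp_guess; assumption)+)

lemma erase_cong_fv:
  "f \<in> erase M \<Longrightarrow> (\<And>x. x \<in> fv M \<Longrightarrow> \<rho> x = \<rho>' x) \<Longrightarrow> f \<rho> = f \<rho>'"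
  using erase_supp[of M] unfolding supp_def by blast

lemma erase_upd_fresh:
  "f \<in> erase M \<Longrightarrow> x \<notin> fv M \<Longrightarrow> f (\<rho>(x := t)) = f \<rho>"
  by (rule erase_cong_fv) auto

lemma sub_bind: "(\<lambda>y. sub (upsub \<sigma>) (bind x \<rho> y)) = bind x (\<lambda>x. sub \<sigma> (\<rho> x))"
  by (auto simp: bind_def sub_upsub_ren_Suc)

lemma ren_bind: "(\<lambda>y. ren (upren \<xi>) (bind x \<rho> y)) = bind x (\<lambda>x. ren \<xi> (\<rho> x))"
  by (auto simp: bind_def ren_upren_ren_Suc)

text \<open>Naturality: an erasure copies environment entries without inspecting them, and the
  regions inserted by \<open>guess\<close> are closed constants that \<open>sub\<close> leaves
  alone.\<close>

lemma erase_sub: "f \<in> erase M \<Longrightarrow> sub \<sigma> (f \<rho>) = f (\<lambda>x. sub \<sigma> (\<rho> x))"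
proof (induction M arbitrary: f \<rho> \<sigma>)
  case (Nu x M)
  have "(\<lambda>y. sub \<sigma> ((\<rho>(x := DLoc r)) y)) = (\<lambda>x. sub \<sigma> (\<rho> x))(x := DLoc r)" for r
    by auto
  then show ?case using Nu by (auto elim!: pw_elims simp del: fun_upd_apply)
qed (auto elim!: pw_elims simp: sub_bind)

lemma erase_ren: "f \<in> erase M \<Longrightarrow> ren \<xi> (f \<rho>) = f (\<lambda>x. ren \<xi> (\<rho> x))"
proof (induction M arbitrary: f \<rho> \<xi>)
  case (Nu x M)
  have "(\<lambda>y. ren \<xi> ((\<rho>(x := DLoc r)) y)) = (\<lambda>x. ren \<xi> (\<rho> x))(x := DLoc r)" for r
    by auto
  then show ?case using Nu by (auto elim!: pw_elims simp del: fun_upd_apply)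
qed (auto elim!: pw_elims simp: ren_bind)

text \<open>Instantiating index 0 undoes the shift made by \<open>bind\<close>. Contracting an
  erased redex is thus an update of the environment, the form in which both the simulation and the
  fundamental lemma use it.\<close>

lemma inst_erase_bind:
  assumes "f \<in> erase M"
  shows "inst v (f (bind x \<rho>)) = f (\<rho>(x := v))"
proof -
  have "(\<lambda>y. inst v (bind x \<rho> y)) = \<rho>(x := v)"
    by (auto simp: bind_def inst_ren_Suc)
  then show ?thesis by (simp add: erase_sub[OF assms])
qed

lemma erase_isval:
  "f \<in> erase V \<Longrightarrow> is_value V \<Longrightarrow> (\<And>x. isval (\<rho> x)) \<Longrightarrow> isval (f \<rho>)"
  by (induction V arbitrary: f) (auto elim!: pw_elims)

section \<open>Named substitution as an operation on erasures\<close>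

definition plug :: "var \<Rightarrow> erasure \<Rightarrow> erasure \<Rightarrow> erasure" where
  "plug x g f = (\<lambda>\<rho>. f (\<rho>(x := g \<rho>)))"

lemma plug_pw1: "plug x g (\<lambda>\<rho>. c (f \<rho>)) = (\<lambda>\<rho>. c (plug x g f \<rho>))"
  by (simp add: plug_def)

lemma plug_pw2: "plug x g (\<lambda>\<rho>. c (f \<rho>) (h \<rho>)) = (\<lambda>\<rho>. c (plug x g f \<rho>) (plug x g h \<rho>))"
  by (simp add: plug_def)

lemma plug_scoped_same: "plug x g (\<lambda>\<rho>. f (bind x \<rho>)) = (\<lambda>\<rho>. f (bind x \<rho>))"
proof -
  have "bind x (\<rho>(x := t)) = bind x \<rho>" for \<rho> t
    by (auto simp: bind_def)
  then show ?thesis by (simp add: plug_def)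
qed

lemma plug_guess_same: "plug x g (\<lambda>\<rho>. f (\<rho>(x := t))) = (\<lambda>\<rho>. f (\<rho>(x := t)))"
  by (simp add: plug_def)

text \<open>Freshness of \<open>y\<close> for \<open>V\<close> is the no-capture condition: below
  the binder, \<open>g\<close> yields just the shift of its outer result.\<close>

lemma plug_scoped:
  assumes g: "g \<in> erase V" "y \<notin> fv V" and "y \<noteq> x"
  shows "plug x g (\<lambda>\<rho>. f (bind y \<rho>)) = (\<lambda>\<rho>. plug x g f (bind y \<rho>))"
proof -
  have "g (bind y \<rho>) = ren Suc (g \<rho>)" for \<rho>
    unfolding erase_ren[OF g(1)]
    by (rule erase_cong_fv[OF g(1)]) (use g(2) in \<open>auto simp: bind_def\<close>)
  moreover have "bind y (\<rho>(x := t)) = (bind y \<rho>)(x := ren Suc t)" for \<rho> t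
    using \<open>y \<noteq> x\<close> by (auto simp: bind_def)
  ultimately show ?thesis by (simp add: plug_def)
qed

lemma plug_guess:
  assumes g: "g \<in> erase V" "y \<notin> fv V" and "y \<noteq> x"
  shows "plug x g (\<lambda>\<rho>. f (\<rho>(y := t))) = (\<lambda>\<rho>. plug x g f (\<rho>(y := t)))"
proof -
  have "(\<rho>(x := s))(y := t) = (\<rho>(y := t))(x := s)" for \<rho> and s :: db
    using \<open>y \<noteq> x\<close> by auto
  then show ?thesis by (simp add: plug_def erase_upd_fresh[OF g])
qed

text \<open>Membership is all that can be expected in general: the copies of \<open>V\<close> in
  \<open>subst V x M\<close> may guess regions independently, while \<open>plug\<close> gives every
  copy the guesses of the one \<open>g\<close>. This is the direction that the simulation
  requires.\<close>

lemma erase_subst: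
  assumes V: "g \<in> erase V"
  shows "f \<in> erase M \<Longrightarrow> bv M \<inter> fv V = {} \<Longrightarrow> plug x g f \<in> erase (subst V x M)"
proof (induction M arbitrary: f)
  case Unit
  then show ?case by (simp add: plug_def)
next
  case (Var y)
  then show ?case using V by (auto simp: plug_def)
next
  case (Lam y M)
  then obtain h where h: "h \<in> erase M" "f = (\<lambda>\<rho>. DLam (h (bind y \<rho>)))"
    by (auto elim!: pw_elims)
  show ?case
  proof (cases "y = x")
    case True
    then show ?thesis
      using h by (auto simp: plug_pw1[of x g DLam] plug_scoped_same intro!: pw_intros)
  next
    case False
    then have "plug x g (\<lambda>\<rho>. h (bind y \<rho>)) \<in> scoped y (erase (subst V x M))"
      using Lam h by (auto simp: plug_scoped[OF V] intro!: scopedI)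
    then show ?thesis
      using h False by (auto simp: plug_pw1[of x g DLam] intro!: pw1I)
  qed
next
  case (Let y M N)
  then obtain h k where h: "h \<in> erase M" "k \<in> erase N"
      "f = (\<lambda>\<rho>. DLet (h \<rho>) (k (bind y \<rho>)))"
    by (auto elim!: pw_elims)
  have M: "plug x g h \<in> erase (subst V x M)" using Let h by auto
  show ?case
  proof (cases "y = x")
    case True
    then show ?thesis
      using h M by (auto simp: plug_pw2[of x g DLet] plug_scoped_same intro!: pw_intros)
  next
    case False
    then have "plug x g (\<lambda>\<rho>. k (bind y \<rho>)) \<in> scoped y (erase (subst V x N))"
      using Let h by (auto simp: plug_scoped[OF V] intro!: scopedI)
    then show ?thesis
      using h M False by (auto simp: plug_pw2[of x g DLet] intro!: pw2I)
  qed
next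
  case (Nu y M)
  then show ?case
    by (cases "y = x") (auto elim!: guessE intro!: guessI
        simp: plug_guess_same plug_guess[OF V] simp del: fun_upd_apply)
qed (auto elim!: pw_elims intro!: pw_intros simp: plug_pw1 plug_pw2 Int_Un_distrib2)

section \<open>Erasure and alpha-equivalence\<close>

definition swaps :: "var \<Rightarrow> var \<Rightarrow> erasure set \<Rightarrow> erasure set" where
  "swaps a b A = (\<lambda>f \<rho>. f (\<rho> \<circ> swapv a b)) ` A"

lemma swaps_pw1: "swaps a b (pw1 c A) = pw1 c (swaps a b A)"
  by (simp add: swaps_def pw1_def image_image)

lemma swaps_pw2: "swaps a b (pw2 c A B) = pw2 c (swaps a b A) (swaps a b B)"
  by (simp add: swaps_def pw2_def image_UN image_image)

lemma swaps_scoped: "swaps a b (scoped x A) = scoped (swapv a b x) (swaps a b A)"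
proof -
  have "bind (swapv a b x) \<rho> \<circ> swapv a b = bind x (\<rho> \<circ> swapv a b)" for \<rho>
    by (auto simp: bind_def swapv_def)
  then show ?thesis by (simp add: swaps_def scoped_def image_image)
qed

lemma swaps_guess: "swaps a b (guess x A) = guess (swapv a b x) (swaps a b A)"
proof -
  have "\<rho>(swapv a b x := t) \<circ> swapv a b = (\<rho> \<circ> swapv a b)(x := t)" for \<rho> and t :: db
    by (auto simp: swapv_def)
  then show ?thesis by (simp add: swaps_def guess_def image_UN image_image)
qed

lemma erase_swap: "erase (swap a b M) = swaps a b (erase M)"
proof (induction M)
  case Unit
  then show ?case by (simp add: swaps_def)
next
  case (Var x)
  then show ?case by (simp add: swaps_def)
qed (simp_all add: swaps_pw1 swaps_pw2 swaps_scoped swaps_guess)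

text \<open>The two environments can differ only at \<open>x\<close>, which is not free in
  \<open>N\<close>; at \<open>y\<close> the swap fetches the index that \<open>bind x\<close> put at
  \<open>x\<close>.\<close>

lemma scoped_rename:
  assumes "x \<notin> fv N"
  shows "scoped x (erase (swap x y N)) = scoped y (erase N)"
proof -
  have "f (bind x \<rho> \<circ> swapv x y) = f (bind y \<rho>)" if "f \<in> erase N" for f \<rho>
    by (rule erase_cong_fv[OF that]) (use assms in \<open>auto simp: bind_def swapv_def\<close>)
  then show ?thesis
    by (auto simp: erase_swap swaps_def scoped_def image_image intro!: image_cong)
qed

lemma guess_rename:
  assumes "x \<notin> fv N"
  shows "guess x (erase (swap x y N)) = guess y (erase N)"
proof -
  have "f (\<rho>(x := t) \<circ> swapv x y) = f (\<rho>(y := t))" if "f \<in> erase N" for f \<rho> t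
    by (rule erase_cong_fv[OF that]) (use assms in \<open>auto simp: swapv_def\<close>)
  then show ?thesis
    by (auto simp: erase_swap swaps_def guess_def image_image intro!: SUP_cong image_cong)
qed

lemma erase_alpha: "alpha M N \<Longrightarrow> erase M = erase N"
  by (induction rule: alpha.induct) (simp_all add: scoped_rename guess_rename)

section \<open>Labelled transitions of erased threads\<close>

datatype lab = Tau | Rd db db | Wr db db

text \<open>Addresses and read results are unconstrained here; \<open>permits\<close> and
  \<open>feeds\<close> impose the discipline. Parallel composition has no rule, because
  \<open>threads\<close> splits it beforehand.\<close>

inductive lstep :: "db \<Rightarrow> lab \<Rightarrow> db \<Rightarrow> bool" where
  ls_beta: "isval v \<Longrightarrow> lstep (DApp (DLam t) v) Tau (inst v t)"
| ls_let: "isval v \<Longrightarrow> lstep (DLet (DBang v) t) Tau (inst v t)"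
| ls_get: "lstep (DGet l) (Rd l v) v"
| ls_set: "lstep (DSet l v) (Wr l v) DUnit"
| ls_appL: "lstep t l t' \<Longrightarrow> lstep (DApp t u) l (DApp t' u)"
| ls_appR: "isval v \<Longrightarrow> lstep u l u' \<Longrightarrow> lstep (DApp v u) l (DApp v u')"
| ls_bang: "lstep t l t' \<Longrightarrow> lstep (DBang t) l (DBang t')"
| ls_letL: "lstep t l t' \<Longrightarrow> lstep (DLet t u) l (DLet t' u)"

inductive_cases lstep_AppE: "lstep (DApp t u) l t'"
inductive_cases lstep_LetE: "lstep (DLet t u) l t'"
inductive_cases lstep_GetE: "lstep (DGet t) l t'"
inductive_cases lstep_SetE: "lstep (DSet t u) l t'"
inductive_cases lstep_BangE: "lstep (DBang t) l t'"
inductive_cases lstep_ParE: "lstep (DPar t u) l t'"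
inductive_cases lstep_StE: "lstep (DSt t u) l t'"

lemma isval_no_lstep: "lstep t l t' \<Longrightarrow> \<not> isval t"
  by (induction rule: lstep.induct) auto

text \<open>A rely-guarantee split: \<open>permits\<close> is what a thread must guarantee about its
  accesses, \<open>feeds\<close> is what it may assume about the values it reads.\<close>

definition permits :: "(reg \<Rightarrow> db set) \<Rightarrow> reg set \<Rightarrow> lab \<Rightarrow> bool" where
  "permits I e l \<longleftrightarrow> (case l of
      Tau \<Rightarrow> True
    | Rd a v \<Rightarrow> \<exists>r\<in>e. a = DLoc r
    | Wr a v \<Rightarrow> \<exists>r\<in>e. a = DLoc r \<and> v \<in> I r)"

definition feeds :: "(reg \<Rightarrow> db set) \<Rightarrow> lab \<Rightarrow> bool" where
  "feeds I l \<longleftrightarrow> (\<forall>r v. l = Rd (DLoc r) v \<longrightarrow> v \<in> I r)"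

text \<open>Accessible threads: a read may be answered by any element of \<open>I r\<close>, not only by what the
store contains.  The region set \<open>e\<close> bounds the accessed regions, so that \<open>gd I e\<close> depends on
\<open>I\<close> at \<open>e\<close> only.\<close>
inductive gd :: "(reg \<Rightarrow> db set) \<Rightarrow> reg set \<Rightarrow> db set \<Rightarrow> db \<Rightarrow> bool" for I e where
  gdI: "(isval t \<Longrightarrow> t \<in> Q) \<Longrightarrow>
    (\<And>a b. t = DPar a b \<Longrightarrow> gd I e UNIV a) \<Longrightarrow>
    (\<And>a b. t = DPar a b \<Longrightarrow> gd I e UNIV b) \<Longrightarrow>
    (\<And>a v. t = DSt a v \<Longrightarrow> \<exists>r\<in>e. a = DLoc r \<and> v \<in> I r) \<Longrightarrow>
    (\<And>l t'. lstep t l t' \<Longrightarrow> permits I e l) \<Longrightarrow>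
    (\<And>l t'. lstep t l t' \<Longrightarrow> feeds I l \<Longrightarrow> gd I e Q t') \<Longrightarrow> gd I e Q t"

lemma gd_isval: "gd I e Q t \<Longrightarrow> isval t \<Longrightarrow> t \<in> Q"
  by (erule gd.cases) simp

lemma gd_Par:
  assumes "gd I e Q (DPar a b)"
  shows "gd I e UNIV a" "gd I e UNIV b"
  using assms by (auto elim: gd.cases)

lemma gd_St: "gd I e Q (DSt a v) \<Longrightarrow> \<exists>r\<in>e. a = DLoc r \<and> v \<in> I r"
  by (erule gd.cases) simp

lemma gd_permits: "gd I e Q t \<Longrightarrow> lstep t l t' \<Longrightarrow> permits I e l"
  by (erule gd.cases) simp

lemma gd_step: "gd I e Q t \<Longrightarrow> lstep t l t' \<Longrightarrow> feeds I l \<Longrightarrow> gd I e Q t'"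
  by (erule gd.cases) simp

lemma permits_mono: "permits I e l \<Longrightarrow> e \<subseteq> e' \<Longrightarrow> permits I e' l"
  by (cases l) (auto simp: permits_def)

lemma gd_mono:
  "gd I e Q t \<Longrightarrow> e \<subseteq> e' \<Longrightarrow> Q \<subseteq> Q' \<Longrightarrow> gd I e' Q' t"
proof (induction arbitrary: Q' rule: gd.induct)
  case (gdI t Q)
  show ?case
  proof (rule gd.gdI)
    show "isval t \<Longrightarrow> t \<in> Q'" using gdI.hyps gdI.prems by blast
    show "gd I e' UNIV a" if "t = DPar a b" for a b
      using gdI.IH(1)[OF that] gdI.prems by blast
    show "gd I e' UNIV b" if "t = DPar a b" for a b
      using gdI.IH(2)[OF that] gdI.prems by blast
    show "\<exists>r\<in>e'. a = DLoc r \<and> v \<in> I r" if "t = DSt a v" for a v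
      using gdI.hyps(4)[OF that] gdI.prems(1) by blast
    show "permits I e' l" if "lstep t l t'" for l t'
      using gdI.hyps(5)[OF that] gdI.prems(1) by (rule permits_mono)
    show "gd I e' Q' t'" if "lstep t l t'" "feeds I l" for l t'
      using gdI.IH(3)[OF that] gdI.prems by blast
  qed
qed

text \<open>By \<open>permits\<close>, every label of an accessible thread concerns a region in
  \<open>e\<close>, where \<open>I\<close> and \<open>J\<close> agree; on those labels
  \<open>feeds\<close> has the same meaning for both.\<close>

lemma gd_cong_regions:
  "gd I e Q t \<Longrightarrow> (\<And>r. r \<in> e \<Longrightarrow> I r = J r) \<Longrightarrow> gd J e Q t"
proof (induction rule: gd.induct)
  case (gdI t Q)
  note eq = gdI.prems
  show ?case
  proof (rule gd.gdI)
    show "isval t \<Longrightarrow> t \<in> Q" using gdI.hyps(1) .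
    show "gd J e UNIV a" if "t = DPar a b" for a b
      using gdI.IH(1)[OF that eq] .
    show "gd J e UNIV b" if "t = DPar a b" for a b
      using gdI.IH(2)[OF that eq] .
    show "\<exists>r\<in>e. a = DLoc r \<and> v \<in> J r" if "t = DSt a v" for a v
      using gdI.hyps(4)[OF that] eq by blast
    show "permits J e l" if "lstep t l t'" for l t'
      using gdI.hyps(5)[OF that] eq by (cases l) (auto simp: permits_def)
    show "gd J e Q t'" if t': "lstep t l t'" and "feeds J l" for l t'
    proof -
      have "feeds I l"
        using gdI.hyps(5)[OF t'] eq \<open>feeds J l\<close> by (cases l) (auto simp: permits_def feeds_def)
      then show ?thesis using gdI.IH(3)[OF t' _ eq] by blast
    qed
  qed
qed

lemma gd_value: "isval t \<Longrightarrow> t \<in> Q \<Longrightarrow> gd I e Q t"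
  by (rule gdI) (auto dest: isval_no_lstep)

text \<open>One layer of an evaluation context, described by its behaviour so that all four shapes
  share a single induction.\<close>

definition frame :: "(db \<Rightarrow> db) \<Rightarrow> bool" where
  "frame F \<longleftrightarrow> (\<forall>t. \<not> isval t \<longrightarrow>
     \<not> isval (F t) \<and> (\<forall>a b. F t \<noteq> DPar a b) \<and> (\<forall>a b. F t \<noteq> DSt a b) \<and>
     (\<forall>l s. lstep (F t) l s \<longrightarrow> (\<exists>t'. lstep t l t' \<and> s = F t')))"

lemma frame_appL: "frame (\<lambda>t. DApp t u)"
  by (auto simp: frame_def elim!: lstep_AppE)

lemma frame_appR: "isval v \<Longrightarrow> frame (DApp v)"
  by (auto simp: frame_def elim!: lstep_AppE dest: isval_no_lstep)

lemma frame_bang: "frame DBang"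
  by (auto simp: frame_def elim!: lstep_BangE)

lemma frame_let: "frame (\<lambda>t. DLet t u)"
  by (auto simp: frame_def elim!: lstep_LetE)

text \<open>The bind principle of reducibility. The induction follows the accessibility of
  \<open>t\<close>: as long as \<open>t\<close> is no value the frame adds no step of its own, and
  once it is one the assumption on \<open>F v\<close> takes over.\<close>

lemma gd_frame:
  assumes F: "frame F"
  shows "gd I e' Q' t \<Longrightarrow> e' \<subseteq> e \<Longrightarrow> (\<And>v. v \<in> Q' \<Longrightarrow> isval v \<Longrightarrow> gd I e Q (F v))
    \<Longrightarrow> gd I e Q (F t)"
proof (induction rule: gd.induct)
  case (gdI t Q')
  show ?case
  proof (cases "isval t")
    case True
    then show ?thesis using gdI.hyps(1) gdI.prems(2) by blast
  next
    case False
    then have Ft: "\<not> isval (F t)" "F t \<noteq> DPar a b" "F t \<noteq> DSt a b" for a b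
      using F unfolding frame_def by blast+
    have st: "lstep (F t) l s \<Longrightarrow> \<exists>t'. lstep t l t' \<and> s = F t'" for l s
      using F False unfolding frame_def by blast
    show ?thesis
    proof (rule gd.gdI)
      show "permits I e l" if "lstep (F t) l s" for l s
        using st[OF that] gdI.hyps(5) gdI.prems(1) permits_mono by blast
      show "gd I e Q s" if s: "lstep (F t) l s" "feeds I l" for l s
      proof -
        obtain t' where t': "lstep t l t'" "s = F t'" using st[OF s(1)] by blast
        show ?thesis
          unfolding t'(2) by (rule gdI.IH(3)[OF t'(1) s(2) gdI.prems])
      qed
    qed (use Ft in auto)
  qed
qed

section \<open>Interpretation of types\<close>

text \<open>Variables inhabit every type but \<open>Reg\<close>; they stand for the free variables of a program, on
which evaluation is stuck.\<close>
primrec ValV :: "(reg \<Rightarrow> db set) \<Rightarrow> vty \<Rightarrow> db set"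
  and ValT :: "(reg \<Rightarrow> db set) \<Rightarrow> ty \<Rightarrow> db set" where
  "ValV I TOne = insert DUnit (range DVar)"
| "ValV I (TArr A e \<alpha>) =
     range DVar \<union> {DLam t | t. \<forall>v \<in> ValV I A. gd I e (ValT I \<alpha>) (inst v t)}"
| "ValV I (TBang A) = range DVar \<union> DBang ` ValV I A"
| "ValV I (TReg r A) = {DLoc r}"
| "ValT I TB = UNIV"
| "ValT I (TV A) = ValV I A"

lemma ValV_isval: "v \<in> ValV I A \<Longrightarrow> isval v"
  and ValT_isval: "v \<in> ValT I \<alpha> \<Longrightarrow> \<alpha> \<noteq> TB \<Longrightarrow> isval v"
  by (induction A and \<alpha> arbitrary: v) auto

text \<open>A bound on the regions at which \<open>ValV I\<close> consults \<open>I\<close>.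
  \<open>TReg\<close> contributes none because its interpretation is the constant
  \<open>{DLoc r}\<close>; the stored type is not unfolded.\<close>

primrec effsV :: "vty \<Rightarrow> reg set" and effsT :: "ty \<Rightarrow> reg set" where
  "effsV TOne = {}"
| "effsV (TArr A e \<alpha>) = effsV A \<union> e \<union> effsT \<alpha>"
| "effsV (TBang A) = effsV A"
| "effsV (TReg r A) = {}"
| "effsT TB = {}"
| "effsT (TV A) = effsV A"

lemma ValV_cong_regions: "(\<And>r. r \<in> effsV A \<Longrightarrow> I r = J r) \<Longrightarrow> ValV I A = ValV J A"
  and ValT_cong_regions: "(\<And>r. r \<in> effsT \<alpha> \<Longrightarrow> I r = J r) \<Longrightarrow> ValT I \<alpha> = ValT J \<alpha>"
proof (induction A and \<alpha>)
  case (TArr A e \<alpha>)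
  have "gd I e Q t \<longleftrightarrow> gd J e Q t" for Q t
    using TArr.prems gd_cong_regions[of I e Q t J] gd_cong_regions[of J e Q t I] by auto
  then show ?case using TArr by simp
qed auto

lemma ValV_subV: "subV R A A' \<Longrightarrow> ValV I A \<subseteq> ValV I A'"
  and ValT_subT: "subT R \<alpha> \<alpha>' \<Longrightarrow> ValT I \<alpha> \<subseteq> ValT I \<alpha>'"
proof (induction rule: subV_subT.inducts)
  case (subV_arr e e' R A' A \<alpha> \<alpha>')
  have "gd I e' (ValT I \<alpha>') t" if "gd I e (ValT I \<alpha>) t" for t
    using that subV_arr by (blast intro: gd_mono)
  then show ?case using subV_arr.IH by (simp add: subset_iff) blast
qed auto

section \<open>Stratification\<close>

abbreviation proj :: "rctx \<Rightarrow> (reg \<times> vty) list" where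
  "proj R \<equiv> map (\<lambda>(r, U, A). (r, A)) R"

text \<open>Sums of region contexts may insert neutral entries with arbitrary, even ill-formed types,
so \<open>I\<close> is only constrained on the well-formed parts of \<open>R\<close>.\<close>
definition sound :: "(reg \<Rightarrow> db set) \<Rightarrow> rctx \<Rightarrow> bool" where
  "sound I R \<longleftrightarrow> (\<forall>R1. subseq (proj R1) (proj R) \<longrightarrow> wfR R1 \<longrightarrow>
     (\<forall>(r, A) \<in> set (proj R1). I r = ValV I A))"

lemma sound_subseq: "sound I R \<Longrightarrow> subseq (proj R1) (proj R) \<Longrightarrow> sound I R1"
  unfolding sound_def using subseq_order.trans by blast

lemma sound_lookup: "sound I R \<Longrightarrow> wfR R \<Longrightarrow> (r, A) \<in> set (proj R) \<Longrightarrow> I r = ValV I A"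
  unfolding sound_def by blast

lemma rext_subseq: "rext R R' \<Longrightarrow> subseq (proj R) (proj R')"
  by (induction rule: rext.induct) auto

lemma rsum_subseq:
  assumes "rsum R1 R2 R"
  shows "subseq (proj R1) (proj R)" "subseq (proj R2) (proj R)"
proof -
  have "subseq (proj R1) (proj R) \<and> subseq (proj R2) (proj R)"
    using assms unfolding rsum_def
  proof (elim conjE exE)
    fix R1' R2'
    assume ext: "rext R1 R1'" "rext R2 R2'"
      and len: "length R1' = length R" "length R2' = length R"
      and nth: "\<forall>i < length R. case (R1' ! i, R2' ! i, R ! i) of
          ((r1, W1, A1), (r2, W2, A2), (r, W, A)) \<Rightarrow>
            r1 = r \<and> r2 = r \<and> A1 = A \<and> A2 = A \<and> rusum W1 W2 = Some W"
    have "proj R1' ! i = proj R ! i \<and> proj R2' ! i = proj R ! i" if "i < length R" for i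
      using nth[rule_format, OF that] that len
      by (cases "R1' ! i"; cases "R2' ! i"; cases "R ! i") simp
    then have "proj R1' = proj R" "proj R2' = proj R"
      using len by (simp_all add: list_eq_iff_nth_eq)
    then show ?thesis
      using rext_subseq[OF ext(1)] rext_subseq[OF ext(2)] by simp
  qed
  then show "subseq (proj R1) (proj R)" "subseq (proj R2) (proj R)" by auto
qed

text \<open>This records only that effects stay inside the domain. The order of declaration is
  recovered by applying it to well-formed prefixes.\<close>

definition stratified :: "rctx \<Rightarrow> bool" where
  "stratified R \<longleftrightarrow> distinct (map fst R) \<and> (\<forall>A \<in> snd ` set (proj R). effsV A \<subseteq> rdom R)"

lemma stratified_snoc:
  assumes "stratified R" "effsV A \<subseteq> rdom R" "r \<notin> rdom R"
  shows "stratified (R @ [(r, U, A)])"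
  using assms by (auto simp: stratified_def rdom_def subset_iff)

lemma wfR_stratified: "wfR R \<Longrightarrow> stratified R"
  and wfV_effs: "wfV R A \<Longrightarrow> wfR R \<and> stratified R \<and> effsV A \<subseteq> rdom R"
  and wfT_effs: "wfT R \<alpha> \<Longrightarrow> wfR R \<and> stratified R \<and> effsT \<alpha> \<subseteq> rdom R"
proof (induction rule: wfR_wfV_wfT.inducts)
  case wf_nil
  show ?case by (simp add: stratified_def)
next
  case (wf_snoc R A r U)
  then show ?case by (simp add: stratified_snoc)
qed simp_all

lemma wfR_effsV: "wfR R \<Longrightarrow> (r, A) \<in> set (proj R) \<Longrightarrow> effsV A \<subseteq> rdom R"
  using wfR_stratified unfolding stratified_def by (metis imageI snd_conv)

lemma rdom_proj: "rdom R = fst ` set (proj R)"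
  by (force simp: rdom_def)

lemma subseq_set: "subseq xs ys \<Longrightarrow> set xs \<subseteq> set ys"
  by (auto simp: subseq_conv_nths dest: in_set_nthsD)

text \<open>The set for the last region is computed from the sets chosen before it. In a well-formed
  part containing that region, its type has effects on earlier regions only, so redefining
  \<open>I\<close> at \<open>r\<close> does not disturb the interpretation just used.\<close>

lemma sound_ex: "distinct (map fst R) \<Longrightarrow> \<exists>I. sound I R"
proof (induction R rule: rev_induct)
  case Nil
  have "sound (\<lambda>r. {}) []"
    unfolding sound_def
  proof (intro allI impI)
    fix R1 assume "subseq (proj R1) (proj [])"
    then have "R1 = []" using subseq_set by fastforce
    then show "\<forall>(r, A) \<in> set (proj R1). {} = ValV (\<lambda>r. {}) A" by simp
  qed
  then show ?case by blast
next
  case (snoc h R)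
  obtain r U A where h: "h = (r, U, A)" by (cases h)
  obtain I where I: "sound I R" using snoc by auto
  define J where "J = I(r := ValV I A)"
  have r: "r \<notin> rdom R" using snoc.prems by (auto simp: h rdom_def)
  \<comment> \<open>A well-formed part of the old context mentions \<open>r\<close> neither in its
    domain nor in its effects, so it cannot tell \<open>J\<close> from \<open>I\<close>.\<close>
  have low: "J s = ValV J B"
    if R1: "subseq (proj R1) (proj R)" "wfR R1" and s: "(s, B) \<in> set (proj R1)" for R1 s B
  proof -
    have dom: "rdom R1 \<subseteq> rdom R"
      unfolding rdom_proj using subseq_set[OF R1(1)] by blast
    have "s \<in> rdom R1" unfolding rdom_proj using s by force
    then have "s \<noteq> r" using dom r by auto
    moreover have "effsV B \<subseteq> rdom R1" using wfR_effsV[OF R1(2) s] .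
    then have "ValV J B = ValV I B"
      using dom r by (intro ValV_cong_regions) (auto simp: J_def)
    ultimately show ?thesis
      using sound_lookup[OF sound_subseq[OF I R1(1)] R1(2) s] by (simp add: J_def)
  qed
  have "\<forall>(s, B) \<in> set (proj R1). J s = ValV J B"
    if R1: "subseq (proj R1) (proj (R @ [h]))" and wf: "wfR R1" for R1
  proof -
    obtain xs ys where xy: "proj R1 = xs @ ys" "subseq xs (proj R)" "subseq ys [(r, A)]"
      using R1 by (auto simp: h subseq_append_iff)
    show ?thesis
    proof (cases "ys = []")
      case True
      then show ?thesis using low[of R1] xy wf by auto
    next
      case False
      then have ys: "ys = [(r, A)]"
        using xy(3) by (cases ys) (auto split: if_splits)
      \<comment> \<open>Inversion exposes a well-formed prefix \<open>R2\<close> over which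
        \<open>A\<close> is formed. It bounds the effects of \<open>A\<close> and excludes
        \<open>r\<close>.\<close>
      from wf show ?thesis
      proof (cases rule: wfR.cases)
        case wf_nil
        then show ?thesis by simp
      next
        case (wf_snoc R2 A' r' U')
        have R2: "proj R2 = xs" "A' = A" "r' = r"
          using wf_snoc(1) xy(1) ys by auto
        have "effsV A \<subseteq> rdom R2" "wfR R2" "r \<notin> rdom R2"
          using wf_snoc wfV_effs R2 by blast+
        moreover from this(1,3) have "ValV J A = ValV I A"
          by (intro ValV_cong_regions) (auto simp: J_def)
        ultimately show ?thesis
          using low[of R2] R2 xy wf_snoc(1) by (auto simp: J_def)
      qed
    qed
  qed
  then show ?case unfolding sound_def by blast
qed

lemma typing_distinct: "typing R G M \<alpha> e \<Longrightarrow> distinct (map fst R)"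
  by (induction rule: typing.induct) (auto simp: rsum_def wfG_def stratified_def dest: wfR_stratified)

section \<open>The fundamental lemma\<close>

text \<open>Values are demanded at all names, also outside \<open>dom G\<close>, because
  \<open>erase_isval\<close> and the simulation are stated for such environments.\<close>

definition env :: "(reg \<Rightarrow> db set) \<Rightarrow> ctx \<Rightarrow> (var \<Rightarrow> db) \<Rightarrow> bool" where
  "env I G \<rho> \<longleftrightarrow> (\<forall>x. isval (\<rho> x)) \<and> (\<forall>x u A. G x = Some (u, A) \<longrightarrow> \<rho> x \<in> ValV I A)"

lemma env_csum:
  assumes "env I G \<rho>" "csum G1 G2 G"
  shows "env I G1 \<rho>" "env I G2 \<rho>"
proof -
  have sub: "\<exists>u'. G x = Some (u', A)" if "G1 x = Some (u, A) \<or> G2 x = Some (u, A)" for x u A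
    using assms(2)[unfolded csum_def, THEN spec[of _ x]] that
    by (auto split: option.splits prod.splits)
  show "env I G1 \<rho>" "env I G2 \<rho>"
    using assms(1) sub unfolding env_def by blast+
qed

lemma env_lookup: "env I G \<rho> \<Longrightarrow> G x = Some (u, A) \<Longrightarrow> \<rho> x \<in> ValV I A"
  unfolding env_def by blast

lemma env_upd:
  "env I G \<rho> \<Longrightarrow> v \<in> ValV I A \<Longrightarrow> env I (G(x \<mapsto> (u, A))) (\<rho>(x := v))"
  using ValV_isval by (auto simp: env_def)

section \<open>Closure of accessibility under the term constructors\<close>

lemma gd_app:
  assumes "gd I e1 (ValV I (TArr A e \<alpha>)) t" "gd I e2 (ValV I A) u"
  shows "gd I (e \<union> e1 \<union> e2) (ValT I \<alpha>) (DApp t u)"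
\<comment> \<open>Two nested frames follow the evaluation order, function before argument; a value
  applied to a value remains.\<close>
proof (rule gd_frame[OF frame_appL assms(1)])
  fix v assume v: "v \<in> ValV I (TArr A e \<alpha>)" "isval v"
  show "gd I (e \<union> e1 \<union> e2) (ValT I \<alpha>) (DApp v u)"
  proof (rule gd_frame[OF frame_appR[OF v(2)] assms(2)])
    fix w assume w: "w \<in> ValV I A" "isval w"
    \<comment> \<open>A variable in function position is stuck, which is why variables may inhabit
      arrow types.\<close>
    have step: "l = Tau \<and> (\<exists>t. v = DLam t \<and> s = inst w t)" if "lstep (DApp v w) l s" for l s
      using that v(2) w(2) by (auto elim!: lstep_AppE dest: isval_no_lstep)
    have body: "gd I (e \<union> e1 \<union> e2) (ValT I \<alpha>) (inst w t)" if "v = DLam t" for t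
      by (rule gd_mono[where e = e and Q = "ValT I \<alpha>"]) (use v(1) w(1) that in auto)
    show "gd I (e \<union> e1 \<union> e2) (ValT I \<alpha>) (DApp v w)"
      by (rule gdI) (use step body in \<open>fastforce simp: permits_def\<close>)+
  qed auto
qed auto

lemma gd_let:
  assumes "gd I e1 (ValV I (TBang A)) t" "\<And>v. v \<in> ValV I A \<Longrightarrow> gd I e2 Q (inst v u)"
  shows "gd I (e1 \<union> e2) Q (DLet t u)"
proof (rule gd_frame[OF frame_let assms(1)])
  fix v assume v: "v \<in> ValV I (TBang A)" "isval v"
  have step: "l = Tau \<and> (\<exists>w. v = DBang w \<and> s = inst w u)" if "lstep (DLet v u) l s" for l s
    using that v(2) by (auto elim!: lstep_LetE dest: isval_no_lstep)
  have body: "gd I (e1 \<union> e2) Q (inst w u)" if "v = DBang w" for w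
    by (rule gd_mono[where e = e2 and Q = Q]) (use v(1) assms(2) that in auto)
  show "gd I (e1 \<union> e2) Q (DLet v u)"
    by (rule gdI) (use step body in \<open>fastforce simp: permits_def\<close>)+
qed auto

lemma gd_bang:
  assumes "gd I e (ValV I A) t"
  shows "gd I e (ValV I (TBang A)) (DBang t)"
  by (rule gd_frame[OF frame_bang assms]) (auto intro!: gd_value)

text \<open>By \<open>feeds\<close> the answer already lies in \<open>I r\<close>, so
  \<open>I r\<close> itself can serve as the set of results; \<open>sound\<close> later identifies
  it with the interpretation of the stored type.\<close>

lemma gd_get:
  assumes "\<And>v. v \<in> I r \<Longrightarrow> isval v"
  shows "gd I {r} (I r) (DGet (DLoc r))"
proof (rule gdI)
  fix l t' assume "lstep (DGet (DLoc r)) l t'"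
  then have l: "l = Rd (DLoc r) t'" by (auto elim: lstep_GetE)
  show "permits I {r} l" by (simp add: l permits_def)
  assume "feeds I l"
  then have "t' \<in> I r" unfolding l feeds_def by blast
  then show "gd I {r} (I r) t'" using assms gd_value by blast
qed auto

lemma gd_set: "v \<in> I r \<Longrightarrow> gd I {r} (insert DUnit Q) (DSet (DLoc r) v)"
  by (rule gdI) (auto elim!: lstep_SetE simp: permits_def intro!: gd_value)

lemma gd_par: "gd I e UNIV a \<Longrightarrow> gd I e UNIV b \<Longrightarrow> gd I e Q (DPar a b)"
  by (rule gdI) (auto elim!: lstep_ParE)

lemma gd_st: "r \<in> e \<Longrightarrow> v \<in> I r \<Longrightarrow> gd I e Q (DSt (DLoc r) v)"
  by (rule gdI) (auto elim!: lstep_StE)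

lemma sound_sumL: "sound I R \<Longrightarrow> rsum R1 R2 R \<Longrightarrow> sound I R1"
  by (rule sound_subseq[OF _ rsum_subseq(1)])

lemma sound_sumR: "sound I R \<Longrightarrow> rsum R1 R2 R \<Longrightarrow> sound I R2"
  by (rule sound_subseq[OF _ rsum_subseq(2)])

lemma sound_head:
  assumes "sound I R" "rsum [(r, U, A)] R' R" "wfG R G"
  shows "I r = ValV I A"
proof (rule sound_lookup[OF assms(1)])
  show "wfR R" using assms(3) by (simp add: wfG_def)
  show "(r, A) \<in> set (proj R)"
    using subseq_set[OF rsum_subseq(1)[OF assms(2)]] by simp
qed

lemma csum_head:
  assumes "env I G \<rho>" "csum [x \<mapsto> (u, TReg r A)] G' G"
  shows "\<rho> x = DLoc r"
  using env_lookup[OF env_csum(1)[OF assms], of x u "TReg r A"] by simp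

text \<open>A syntactic value erases to a value, so its accessibility gives membership in the
  interpretation without any evaluation; \<open>sound\<close> turns that into membership in
  \<open>I r\<close>.\<close>

lemma store_item_sound:
  assumes I: "sound I R" "rsum [(r, U, A)] R' R" "wfG R G"
    and csum: "csum [x \<mapsto> (u, TReg r A)] G' G"
    and V: "is_value V" "f \<in> erase V" "\<forall>\<rho>. env I G' \<rho> \<longrightarrow> gd I {} (ValV I A) (f \<rho>)"
    and \<rho>: "env I G \<rho>"
  shows "\<rho> x = DLoc r" "f \<rho> \<in> I r"
proof -
  show "\<rho> x = DLoc r" using csum_head[OF \<rho> csum] .
  have "isval (f \<rho>)" using erase_isval[OF V(2,1)] \<rho> by (simp add: env_def)
  then show "f \<rho> \<in> I r"
    using V(3) env_csum(2)[OF \<rho> csum] gd_isval sound_head[OF I] by blast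
qed

lemma is_value_is_term: "is_value V \<Longrightarrow> is_term V"
  by (induction V) auto

lemma term_not_store: "is_term M \<Longrightarrow> \<not> is_store M"
  by (induction M) auto

text \<open>The erasure is chosen before the environment: its guess at each nu is the region in the
  type that the derivation gives to the bound name. Sums of contexts are merely projected, as
  \<open>sound\<close> and \<open>env\<close> pass to both summands.\<close>

lemma typing_term_gd:
  "typing R G M \<alpha> e \<Longrightarrow> is_term M \<Longrightarrow> sound I R \<Longrightarrow>
    \<exists>f \<in> erase M. \<forall>\<rho>. env I G \<rho> \<longrightarrow> gd I e (ValT I \<alpha>) (f \<rho>)"
proof (induction rule: typing.induct)
  case (t_sub R G M \<alpha> e \<alpha>' e')
  then obtain f where f: "f \<in> erase M" "\<forall>\<rho>. env I G \<rho> \<longrightarrow> gd I e (ValT I \<alpha>) (f \<rho>)"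
    by blast
  have "e \<subseteq> e'" "ValT I \<alpha> \<subseteq> ValT I \<alpha>'"
    using t_sub.hyps(3) ValT_subT unfolding subE_def by blast+
  then show ?case using f gd_mono by blast
next
  case (t_var R G x u A)
  have "gd I {} (ValV I A) (\<rho> x)" if "env I G \<rho>" for \<rho>
    using env_lookup[OF that t_var.hyps(2)] ValV_isval gd_value by blast
  then show ?case by simp
next
  case (t_unit R G)
  then show ?case by (simp add: gd_value)
next
  case (t_abs x G R A M \<alpha> e)
  obtain f where f: "f \<in> erase M"
      "\<forall>\<rho>. env I (G(x \<mapsto> (U1, A))) \<rho> \<longrightarrow> gd I e (ValT I \<alpha>) (f \<rho>)"
    using t_abs.IH t_abs.prems unfolding is_term.simps by blast
  show ?case
  proof (intro bexI allI impI)
    show "(\<lambda>\<rho>. DLam (f (bind x \<rho>))) \<in> erase (Lam x M)"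
      using f(1) by (auto intro!: pw_intros)
    fix \<rho> assume \<rho>: "env I G \<rho>"
    have "gd I e (ValT I \<alpha>) (inst v (f (bind x \<rho>)))" if "v \<in> ValV I A" for v
      using f(2) env_upd[OF \<rho> that] by (simp add: inst_erase_bind[OF f(1)])
    then show "gd I {} (ValT I (TV (TArr A e \<alpha>))) (DLam (f (bind x \<rho>)))"
      by (intro gd_value) auto
  qed
next
  case (t_app R1 G1 M A e \<alpha> e' R2 G2 N e'' R G)
  have s: "sound I R1" "sound I R2"
    using t_app.prems(2) t_app.hyps(3) by (rule sound_sumL, rule sound_sumR)
  obtain f where f: "f \<in> erase M" "\<forall>\<rho>. env I G1 \<rho> \<longrightarrow> gd I e' (ValV I (TArr A e \<alpha>)) (f \<rho>)"
    using t_app.IH(1) t_app.prems s by auto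
  obtain g where g: "g \<in> erase N" "\<forall>\<rho>. env I G2 \<rho> \<longrightarrow> gd I e'' (ValV I A) (g \<rho>)"
    using t_app.IH(2) t_app.prems s by auto
  show ?case
  proof (intro bexI allI impI)
    show "(\<lambda>\<rho>. DApp (f \<rho>) (g \<rho>)) \<in> erase (App M N)"
      using f(1) g(1) by (auto intro!: pw2I)
    fix \<rho> assume \<rho>: "env I G \<rho>"
    show "gd I (e \<union> e' \<union> e'') (ValT I \<alpha>) (DApp (f \<rho>) (g \<rho>))"
      using f(2) g(2) env_csum[OF \<rho> t_app.hyps(4)] by (blast intro: gd_app)
  qed
next
  case (t_prom R R' R0 G G' G0 M A e)
  have s: "sound I R"
    using t_prom.prems(2) t_prom.hyps(1) by (rule sound_sumL)
  obtain f where f: "f \<in> erase M" "\<forall>\<rho>. env I G \<rho> \<longrightarrow> gd I e (ValV I A) (f \<rho>)"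
    using t_prom.IH t_prom.prems s by auto
  show ?case
  proof (intro bexI allI impI)
    show "(\<lambda>\<rho>. DBang (f \<rho>)) \<in> erase (Bang M)"
      using f(1) by (auto intro!: pw1I)
    fix \<rho> assume \<rho>: "env I G0 \<rho>"
    show "gd I e (ValT I (TV (TBang A))) (DBang (f \<rho>))"
      using f(2) env_csum(1)[OF \<rho> t_prom.hyps(2)] gd_bang by simp
  qed
next
  case (t_let R1 G1 M A e x G2 R2 N \<alpha> e' R G)
  have s: "sound I R1" "sound I R2"
    using t_let.prems(2) t_let.hyps(4) by (rule sound_sumL, rule sound_sumR)
  obtain f where f: "f \<in> erase M" "\<forall>\<rho>. env I G1 \<rho> \<longrightarrow> gd I e (ValV I (TBang A)) (f \<rho>)"
    using t_let.IH(1) t_let.prems s by auto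
  obtain g where g: "g \<in> erase N"
      "\<forall>\<rho>. env I (G2(x \<mapsto> (UInf, A))) \<rho> \<longrightarrow> gd I e' (ValT I \<alpha>) (g \<rho>)"
    using t_let.IH(2) t_let.prems s unfolding is_term.simps by blast
  show ?case
  proof (intro bexI allI impI)
    show "(\<lambda>\<rho>. DLet (f \<rho>) (g (bind x \<rho>))) \<in> erase (Let x M N)"
      using f(1) g(1) scopedI[OF g(1)] by (auto intro!: pw2I)
    fix \<rho> assume \<rho>: "env I G \<rho>"
    have "gd I e' (ValT I \<alpha>) (inst v (g (bind x \<rho>)))" if "v \<in> ValV I A" for v
      using g(2) env_upd[OF env_csum(2)[OF \<rho> t_let.hyps(5)] that]
      by (simp add: inst_erase_bind[OF g(1)])
    then show "gd I (e \<union> e') (ValT I \<alpha>) (DLet (f \<rho>) (g (bind x \<rho>)))"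
      using f(2) env_csum(1)[OF \<rho> t_let.hyps(5)] by (blast intro: gd_let)
  qed
next
  case (t_new x G u R r A P \<alpha> e)
  obtain f where f: "f \<in> erase P"
      "\<forall>\<rho>. env I (G(x \<mapsto> (u, TReg r A))) \<rho> \<longrightarrow> gd I e (ValT I \<alpha>) (f \<rho>)"
    using t_new.IH t_new.prems unfolding is_term.simps by blast
  show ?case
  proof (intro bexI allI impI)
    show "(\<lambda>\<rho>. f (\<rho>(x := DLoc r))) \<in> erase (Nu x P)"
      using f(1) by (auto intro!: guessI)
    fix \<rho> assume \<rho>: "env I G \<rho>"
    show "gd I e (ValT I \<alpha>) (f (\<rho>(x := DLoc r)))"
      using f(2) env_upd[OF \<rho>] by simp
  qed
next
  case (t_get R G x u r A v v')
  show ?case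
  proof (intro bexI allI impI)
    show "(\<lambda>\<rho>. DGet (\<rho> x)) \<in> erase (Get (Var x))"
      by (simp add: pw1_def)
    fix \<rho> assume \<rho>: "env I G \<rho>"
    have "(r, A) \<in> set (proj R)" using t_get.hyps(3) by force
    then have "I r = ValV I A"
      using sound_lookup t_get.prems(2) t_get.hyps(1) wfG_def by blast
    moreover have "\<rho> x = DLoc r" using env_lookup[OF \<rho> t_get.hyps(2)] by simp
    ultimately show "gd I {r} (ValT I (TV A)) (DGet (\<rho> x))"
      using gd_get[of I r] ValV_isval by simp
  qed
next
  case (t_set x u r A G' G v v' R' R V)
  have "sound I R'" using t_set.prems(2) t_set.hyps(4) by (rule sound_sumR)
  then obtain f where f: "f \<in> erase V" "\<forall>\<rho>. env I G' \<rho> \<longrightarrow> gd I {} (ValV I A) (f \<rho>)"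
    using t_set.IH is_value_is_term[OF t_set.hyps(7)] by auto
  show ?case
  proof (intro bexI allI impI)
    show "(\<lambda>\<rho>. DSet (\<rho> x) (f \<rho>)) \<in> erase (SetT (Var x) V)"
      using f(1) by (auto intro!: pw2I)
    fix \<rho> assume \<rho>: "env I G \<rho>"
    note store_item_sound[OF t_set.prems(2) t_set.hyps(4,6,1,7) f \<rho>]
    then show "gd I {r} (ValT I (TV TOne)) (DSet (\<rho> x) (f \<rho>))"
      by (simp add: gd_set)
  qed
next
  case (t_pset x u r A G' G v v' R' R V)
  have "sound I R'" using t_pset.prems(2) t_pset.hyps(4) by (rule sound_sumR)
  then obtain f where f: "f \<in> erase V" "\<forall>\<rho>. env I G' \<rho> \<longrightarrow> gd I {} (ValV I (TBang A)) (f \<rho>)"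
    using t_pset.IH is_value_is_term[OF t_pset.hyps(7)] by auto
  show ?case
  proof (intro bexI allI impI)
    show "(\<lambda>\<rho>. DSet (\<rho> x) (f \<rho>)) \<in> erase (PSetT (Var x) V)"
      using f(1) by (auto intro!: pw2I)
    fix \<rho> assume \<rho>: "env I G \<rho>"
    note store_item_sound[OF t_pset.prems(2) t_pset.hyps(4,6,1,7) f \<rho>]
    then show "gd I {r} (ValT I (TV TOne)) (DSet (\<rho> x) (f \<rho>))"
      by (simp add: gd_set)
  qed
next
  case (t_par R1 G1 P1 \<alpha>1 e1 R2 G2 P2 \<alpha>2 e2 R G)
  have s: "sound I R1" "sound I R2"
    using t_par.prems(2) t_par.hyps(5) by (rule sound_sumL, rule sound_sumR)
  obtain f where f: "f \<in> erase P1" "\<forall>\<rho>. env I G1 \<rho> \<longrightarrow> gd I e1 (ValT I \<alpha>1) (f \<rho>)"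
    using t_par.IH(1) t_par.prems s by auto
  obtain g where g: "g \<in> erase P2" "\<forall>\<rho>. env I G2 \<rho> \<longrightarrow> gd I e2 (ValT I \<alpha>2) (g \<rho>)"
    using t_par.IH(2) t_par.prems s by auto
  show ?case
  proof (intro bexI allI impI)
    show "(\<lambda>\<rho>. DPar (f \<rho>) (g \<rho>)) \<in> erase (Par P1 P2)"
      using f(1) g(1) by (auto intro!: pw2I)
    fix \<rho> assume \<rho>: "env I G \<rho>"
    show "gd I (e1 \<union> e2) (ValT I TB) (DPar (f \<rho>) (g \<rho>))"
      using f(2) g(2) env_csum[OF \<rho> t_par.hyps(6)] by (blast intro: gd_par gd_mono)
  qed
\<comment> \<open>The remaining rules type stores or compositions with a store, which are not
  terms.\<close>
qed (auto dest: term_not_store)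

lemma term_prog_gd:
  assumes "typing R G M \<alpha> e" "is_term M" "sound I R"
  shows "\<exists>f \<in> erase M. \<forall>\<rho>. env I G \<rho> \<longrightarrow> gd I UNIV UNIV (f \<rho>)"
proof -
  obtain f where "f \<in> erase M" "\<forall>\<rho>. env I G \<rho> \<longrightarrow> gd I e (ValT I \<alpha>) (f \<rho>)"
    using typing_term_gd[OF assms] by blast
  then show ?thesis using gd_mono[OF _ subset_UNIV subset_UNIV] by blast
qed

lemma prog_gd_Par:
  assumes P: "is_prog P \<Longrightarrow> sound I R1 \<Longrightarrow>
      \<exists>f \<in> erase P. \<forall>\<rho>. env I G1 \<rho> \<longrightarrow> gd I UNIV UNIV (f \<rho>)"
    and Q: "is_prog Q \<Longrightarrow> sound I R2 \<Longrightarrow>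
      \<exists>f \<in> erase Q. \<forall>\<rho>. env I G2 \<rho> \<longrightarrow> gd I UNIV UNIV (f \<rho>)"
    and sums: "rsum R1 R2 R" "csum G1 G2 G"
    and PQ: "is_prog (Par P Q)" "sound I R"
  shows "\<exists>f \<in> erase (Par P Q). \<forall>\<rho>. env I G \<rho> \<longrightarrow> gd I UNIV UNIV (f \<rho>)"
proof -
  obtain f where f: "f \<in> erase P" "\<forall>\<rho>. env I G1 \<rho> \<longrightarrow> gd I UNIV UNIV (f \<rho>)"
    using P PQ sound_sumL[OF PQ(2) sums(1)] by auto
  obtain g where g: "g \<in> erase Q" "\<forall>\<rho>. env I G2 \<rho> \<longrightarrow> gd I UNIV UNIV (g \<rho>)"
    using Q PQ sound_sumR[OF PQ(2) sums(1)] by auto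
  show ?thesis
  proof (intro bexI allI impI)
    show "(\<lambda>\<rho>. DPar (f \<rho>) (g \<rho>)) \<in> erase (Par P Q)"
      using f(1) g(1) by (auto intro!: pw2I)
    fix \<rho> assume \<rho>: "env I G \<rho>"
    show "gd I UNIV UNIV (DPar (f \<rho>) (g \<rho>))"
      using f(2) g(2) env_csum[OF \<rho> sums(2)] by (blast intro: gd_par)
  qed
qed

text \<open>Type and effect are forgotten at program level, hence the two \<open>UNIV\<close>: a
  store item is typed with effect \<open>{}\<close>, yet its accessibility refers to the region it
  occupies.\<close>

lemma typing_prog_gd:
  "typing R G P \<alpha> e \<Longrightarrow> is_prog P \<Longrightarrow> sound I R \<Longrightarrow>
    \<exists>f \<in> erase P. \<forall>\<rho>. env I G \<rho> \<longrightarrow> gd I UNIV UNIV (f \<rho>)"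
proof (induction rule: typing.induct)
  case (t_new x G u R r A P \<alpha> e)
  obtain f where f: "f \<in> erase P"
      "\<forall>\<rho>. env I (G(x \<mapsto> (u, TReg r A))) \<rho> \<longrightarrow> gd I UNIV UNIV (f \<rho>)"
    using t_new.IH t_new.prems unfolding is_prog.simps by blast
  show ?case
  proof (intro bexI allI impI)
    show "(\<lambda>\<rho>. f (\<rho>(x := DLoc r))) \<in> erase (Nu x P)"
      using f(1) by (auto intro!: guessI)
    fix \<rho> assume \<rho>: "env I G \<rho>"
    show "gd I UNIV UNIV (f (\<rho>(x := DLoc r)))"
      using f(2) env_upd[OF \<rho>] by simp
  qed
next
  case (t_store x u r A G' G v v' R' R V)
  have "sound I R'" using t_store.prems(2) t_store.hyps(4) by (rule sound_sumR)
  then obtain f where f: "f \<in> erase V" "\<forall>\<rho>. env I G' \<rho> \<longrightarrow> gd I {} (ValV I A) (f \<rho>)"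
    using typing_term_gd[OF t_store.hyps(8) is_value_is_term[OF t_store.hyps(7)]] by auto
  show ?case
  proof (intro bexI allI impI)
    show "(\<lambda>\<rho>. DSt (\<rho> x) (f \<rho>)) \<in> erase (StV (Var x) V)"
      using f(1) by (auto intro!: pw2I)
    fix \<rho> assume \<rho>: "env I G \<rho>"
    note store_item_sound[OF t_store.prems(2) t_store.hyps(4,6,1,7) f \<rho>]
    then show "gd I UNIV UNIV (DSt (\<rho> x) (f \<rho>))"
      by (simp add: gd_st)
  qed
next
  case (t_pstore x u r A G' G v v' R' R V)
  have "sound I R'" using t_pstore.prems(2) t_pstore.hyps(4) by (rule sound_sumR)
  then obtain f where f: "f \<in> erase V"
      "\<forall>\<rho>. env I G' \<rho> \<longrightarrow> gd I {} (ValV I (TBang A)) (f \<rho>)"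
    using typing_term_gd[OF t_pstore.hyps(8) is_value_is_term[OF t_pstore.hyps(7)]] by auto
  show ?case
  proof (intro bexI allI impI)
    show "(\<lambda>\<rho>. DSt (\<rho> x) (f \<rho>)) \<in> erase (StP (Var x) V)"
      using f(1) by (auto intro!: pw2I)
    fix \<rho> assume \<rho>: "env I G \<rho>"
    note store_item_sound[OF t_pstore.prems(2) t_pstore.hyps(4,6,1,7) f \<rho>]
    then show "gd I UNIV UNIV (DSt (\<rho> x) (f \<rho>))"
      by (simp add: gd_st)
  qed
next
  case (t_par_store1 R1 G1 P \<alpha> e R2 G2 S R G)
  show ?case
    by (rule prog_gd_Par[OF t_par_store1.IH t_par_store1.hyps(4,5) t_par_store1.prems])
next
  case (t_par_store2 R1 G1 P \<alpha> e R2 G2 S R G)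
  show ?case
    by (rule prog_gd_Par[OF t_par_store2.IH(2,1) t_par_store2.hyps(4,5) t_par_store2.prems])
next
  case (t_par R1 G1 P1 \<alpha>1 e1 R2 G2 P2 \<alpha>2 e2 R G)
  show ?case
    by (rule prog_gd_Par[OF t_par.IH t_par.hyps(5,6) t_par.prems])
next
  case t_sub
  show ?case
    by (rule term_prog_gd[OF typing.t_sub[OF t_sub.hyps]]) (use t_sub in simp_all)
next
  case t_var
  show ?case
    by (rule term_prog_gd[OF typing.t_var[OF t_var.hyps]]) (use t_var.prems in simp_all)
next
  case t_unit
  show ?case
    by (rule term_prog_gd[OF typing.t_unit[OF t_unit.hyps]]) (use t_unit.prems in simp_all)
next
  case t_abs
  show ?case
    by (rule term_prog_gd[OF typing.t_abs[OF t_abs.hyps]]) (use t_abs.prems in simp_all)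
next
  case t_app
  show ?case
    by (rule term_prog_gd[OF typing.t_app[OF t_app.hyps]]) (use t_app.prems in simp_all)
next
  case t_prom
  show ?case
    by (rule term_prog_gd[OF typing.t_prom[OF t_prom.hyps]]) (use t_prom.prems in simp_all)
next
  case t_let
  show ?case
    by (rule term_prog_gd[OF typing.t_let[OF t_let.hyps]]) (use t_let.prems in simp_all)
next
  case t_get
  show ?case
    by (rule term_prog_gd[OF typing.t_get[OF t_get.hyps]]) (use t_get.prems in simp_all)
next
  case t_set
  show ?case
    by (rule term_prog_gd[OF typing.t_set[OF t_set.hyps]]) (use t_set.prems in simp_all)
next
  case t_pset
  show ?case
    by (rule term_prog_gd[OF typing.t_pset[OF t_pset.hyps]]) (use t_pset.prems in simp_all)
qed

section \<open>Simulation\<close>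

primrec threads :: "db \<Rightarrow> db multiset" where
  "threads DUnit = {#DUnit#}"
| "threads (DVar n) = {#DVar n#}"
| "threads (DLoc r) = {#DLoc r#}"
| "threads (DLam t) = {#DLam t#}"
| "threads (DBang t) = {#DBang t#}"
| "threads (DApp t u) = {#DApp t u#}"
| "threads (DLet t u) = {#DLet t u#}"
| "threads (DSet t u) = {#DSet t u#}"
| "threads (DGet t) = {#DGet t#}"
| "threads (DPar t u) = threads t + threads u"
| "threads (DSt t u) = {#DSt t u#}"

lemma threads_lstep: "lstep t l t' \<Longrightarrow> threads t = {#t#}"
  by (induction rule: lstep.induct) auto

text \<open>Still a function of the environment, because an enclosing nu has yet to update
  it.\<close>

definition pool :: "tm \<Rightarrow> ((var \<Rightarrow> db) \<Rightarrow> db multiset) set" where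
  "pool P = (\<lambda>f \<rho>. threads (f \<rho>)) ` erase P"

lemma poolI: "f \<in> erase P \<Longrightarrow> (\<lambda>\<rho>. threads (f \<rho>)) \<in> pool P"
  by (auto simp: pool_def)

lemma pool_Par: "pool (Par P Q) = (\<Union>a \<in> pool P. (\<lambda>b \<rho>. a \<rho> + b \<rho>) ` pool Q)"
  by (simp add: pool_def pw2_def image_UN image_image)

lemma pool_Nu: "pool (Nu x P) = (\<Union>r. (\<lambda>a \<rho>. a (\<rho>(x := DLoc r))) ` pool P)"
  by (simp add: pool_def guess_def image_UN image_image)

text \<open>Scope extrusion on erasures: the right operand ignores \<open>x\<close>, so the region
  may equally be chosen outside both operands.\<close>

lemma pw2_guess_left:
  assumes B: "\<forall>g\<in>B. supp X g" "x \<notin> X"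
  shows "pw2 c (guess x A) B = guess x (pw2 c A B)"
proof -
  have B': "g (\<rho>(x := t)) = g \<rho>" if "g \<in> B" for g \<rho> t
  proof -
    have "\<forall>y\<in>X. (\<rho>(x := t)) y = \<rho> y" using B(2) by auto
    then show ?thesis using B(1) that unfolding supp_def by blast
  qed
  have "h \<in> guess x (pw2 c A B)" if h: "h \<in> pw2 c (guess x A) B" for h
  proof -
    obtain k g where k: "k \<in> guess x A" "g \<in> B" "h = (\<lambda>\<rho>. c (k \<rho>) (g \<rho>))"
      using h unfolding pw2_def by blast
    obtain f r where "f \<in> A" "k = (\<lambda>\<rho>. f (\<rho>(x := DLoc r)))"
      using k(1) unfolding guess_def by blast
    then have fg: "f \<in> A" "g \<in> B" "h = (\<lambda>\<rho>. c (f (\<rho>(x := DLoc r))) (g \<rho>))"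
      using k by simp_all
    then show ?thesis
      using guessI[OF pw2I[OF fg(1,2), of c], of x r] by (simp add: B'[OF fg(2)])
  qed
  moreover have "h \<in> pw2 c (guess x A) B" if h: "h \<in> guess x (pw2 c A B)" for h
  proof -
    obtain k r where k: "k \<in> pw2 c A B" "h = (\<lambda>\<rho>. k (\<rho>(x := DLoc r)))"
      using h unfolding guess_def by blast
    obtain f g where "f \<in> A" "g \<in> B" "k = (\<lambda>\<rho>. c (f \<rho>) (g \<rho>))"
      using k(1) unfolding pw2_def by blast
    then have fg: "f \<in> A" "g \<in> B"
        "h = (\<lambda>\<rho>. c (f (\<rho>(x := DLoc r))) (g (\<rho>(x := DLoc r))))"
      using k by simp_all
    then show ?thesis
      using pw2I[OF guessI[OF fg(1), of x r] fg(2), of c] by (simp add: B'[OF fg(2)])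
  qed
  ultimately show ?thesis by blast
qed

lemma pw2_flip: "pw2 c A B = pw2 (\<lambda>a b. c b a) B A"
  by (auto simp: pw2_def)

lemma erase_efill_Nu:
  "x \<notin> fv_ectx E \<Longrightarrow> erase (efill E (Nu x M)) = guess x (erase (efill E M))"
proof (induction E)
  case EHole
  show ?case by simp
next
  case (EAppL E N)
  then show ?case using pw2_guess_left[OF erase_supp] by simp
next
  case (EAppR V E)
  then show ?case
    using pw2_guess_left[OF erase_supp] by (simp add: pw2_flip[of DApp])
next
  case (EBang E)
  then show ?case by (simp add: pw1_def guess_def image_UN image_image)
next
  case (ELet y E N)
  then show ?case
    using pw2_guess_left[OF supp_scoped[OF erase_supp]] by simp
qed

lemma pool_sequiv: "sequiv P Q \<Longrightarrow> pool P = pool Q"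
proof (induction rule: sequiv.induct)
  case (s_alpha P Q)
  then show ?case by (simp add: pool_def erase_alpha)
next
  case (s_comm P Q)
  have "pool (Par P Q) \<subseteq> pool (Par Q P)" for P Q
  proof
    fix h assume "h \<in> pool (Par P Q)"
    then obtain a b where ab: "a \<in> pool P" "b \<in> pool Q" "h = (\<lambda>\<rho>. a \<rho> + b \<rho>)"
      unfolding pool_Par by blast
    have "h = (\<lambda>\<rho>. b \<rho> + a \<rho>)" by (simp add: ab(3) add.commute)
    then show "h \<in> pool (Par Q P)" unfolding pool_Par using ab by blast
  qed
  then show ?case by blast
next
  case (s_assoc P Q R)
  show ?case unfolding pool_Par by (simp add: image_UN image_image add.assoc) blast
next
  case (s_extr P Q x)
  then have "erase (Par (Nu x P) Q) = erase (Nu x (Par P Q))"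
    using pw2_guess_left[OF erase_supp] by simp
  then show ?case by (simp add: pool_def)
next
  case (s_enu E M x)
  then show ?case by (simp add: pool_def erase_efill_Nu)
qed (simp_all add: pool_Par pool_Nu)

text \<open>Decomposition and refilling at once: \<open>f'\<close> keeps the guesses that
  \<open>f\<close> made in the context and exchanges only the erasure at the hole. Environments of
  values are required by \<open>EAppR\<close>, whose left side must erase to a value.\<close>

lemma erase_efill:
  assumes "wf_ectx E" "f \<in> erase (efill E M)"
  obtains a where "a \<in> erase M"
    and "\<And>M' a'. a' \<in> erase M' \<Longrightarrow> \<exists>f' \<in> erase (efill E M'). \<forall>\<rho> l.
          (\<forall>x. isval (\<rho> x)) \<longrightarrow> lstep (a \<rho>) l (a' \<rho>) \<longrightarrow> lstep (f \<rho>) l (f' \<rho>)"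
proof -
  have "\<exists>a \<in> erase M. \<forall>M'. \<forall>a' \<in> erase M'. \<exists>f' \<in> erase (efill E M'). \<forall>\<rho> l.
          (\<forall>x. isval (\<rho> x)) \<longrightarrow> lstep (a \<rho>) l (a' \<rho>) \<longrightarrow> lstep (f \<rho>) l (f' \<rho>)"
    using assms
  proof (induction E arbitrary: f)
    case EHole
    then show ?case by auto
  next
    case (EAppL E N)
    then obtain h g where f: "h \<in> erase (efill E M)" "g \<in> erase N" "f = (\<lambda>\<rho>. DApp (h \<rho>) (g \<rho>))"
      by (auto elim: pw2E)
    obtain a where a: "a \<in> erase M" "\<forall>M'. \<forall>a' \<in> erase M'. \<exists>f' \<in> erase (efill E M'). \<forall>\<rho> l.
          (\<forall>x. isval (\<rho> x)) \<longrightarrow> lstep (a \<rho>) l (a' \<rho>) \<longrightarrow> lstep (h \<rho>) l (f' \<rho>)"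
      using EAppL.IH[OF _ f(1)] EAppL.prems by auto
    show ?case
    proof (intro bexI[OF _ a(1)] allI ballI)
      fix M' a' assume "a' \<in> erase M'"
      then obtain h' where h': "h' \<in> erase (efill E M')" "\<forall>\<rho> l.
          (\<forall>x. isval (\<rho> x)) \<longrightarrow> lstep (a \<rho>) l (a' \<rho>) \<longrightarrow> lstep (h \<rho>) l (h' \<rho>)"
        using a(2) by blast
      show "\<exists>f' \<in> erase (efill (EAppL E N) M'). \<forall>\<rho> l.
          (\<forall>x. isval (\<rho> x)) \<longrightarrow> lstep (a \<rho>) l (a' \<rho>) \<longrightarrow> lstep (f \<rho>) l (f' \<rho>)"
        by (rule bexI[where x = "\<lambda>\<rho>. DApp (h' \<rho>) (g \<rho>)"])
          (use h' f in \<open>auto intro!: pw2I ls_appL\<close>)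
    qed
  next
    case (EAppR V E)
    then obtain h g where f: "g \<in> erase V" "h \<in> erase (efill E M)" "f = (\<lambda>\<rho>. DApp (g \<rho>) (h \<rho>))"
      by (auto elim: pw2E)
    obtain a where a: "a \<in> erase M" "\<forall>M'. \<forall>a' \<in> erase M'. \<exists>f' \<in> erase (efill E M'). \<forall>\<rho> l.
          (\<forall>x. isval (\<rho> x)) \<longrightarrow> lstep (a \<rho>) l (a' \<rho>) \<longrightarrow> lstep (h \<rho>) l (f' \<rho>)"
      using EAppR.IH[OF _ f(2)] EAppR.prems by auto
    have V: "isval (g \<rho>)" if "\<forall>x. isval (\<rho> x)" for \<rho>
      using erase_isval[OF f(1)] that EAppR.prems(1) by simp
    show ?case
    proof (intro bexI[OF _ a(1)] allI ballI)
      fix M' a' assume "a' \<in> erase M'"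
      then obtain h' where h': "h' \<in> erase (efill E M')" "\<forall>\<rho> l.
          (\<forall>x. isval (\<rho> x)) \<longrightarrow> lstep (a \<rho>) l (a' \<rho>) \<longrightarrow> lstep (h \<rho>) l (h' \<rho>)"
        using a(2) by blast
      show "\<exists>f' \<in> erase (efill (EAppR V E) M'). \<forall>\<rho> l.
          (\<forall>x. isval (\<rho> x)) \<longrightarrow> lstep (a \<rho>) l (a' \<rho>) \<longrightarrow> lstep (f \<rho>) l (f' \<rho>)"
        by (rule bexI[where x = "\<lambda>\<rho>. DApp (g \<rho>) (h' \<rho>)"])
          (use h' f V in \<open>auto intro!: pw2I ls_appR\<close>)
    qed
  next
    case (EBang E)
    then obtain h where f: "h \<in> erase (efill E M)" "f = (\<lambda>\<rho>. DBang (h \<rho>))"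
      by (auto elim: pw1E)
    obtain a where a: "a \<in> erase M" "\<forall>M'. \<forall>a' \<in> erase M'. \<exists>f' \<in> erase (efill E M'). \<forall>\<rho> l.
          (\<forall>x. isval (\<rho> x)) \<longrightarrow> lstep (a \<rho>) l (a' \<rho>) \<longrightarrow> lstep (h \<rho>) l (f' \<rho>)"
      using EBang.IH[OF _ f(1)] EBang.prems by auto
    show ?case
    proof (intro bexI[OF _ a(1)] allI ballI)
      fix M' a' assume "a' \<in> erase M'"
      then obtain h' where h': "h' \<in> erase (efill E M')" "\<forall>\<rho> l.
          (\<forall>x. isval (\<rho> x)) \<longrightarrow> lstep (a \<rho>) l (a' \<rho>) \<longrightarrow> lstep (h \<rho>) l (h' \<rho>)"
        using a(2) by blast
      show "\<exists>f' \<in> erase (efill (EBang E) M'). \<forall>\<rho> l.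
          (\<forall>x. isval (\<rho> x)) \<longrightarrow> lstep (a \<rho>) l (a' \<rho>) \<longrightarrow> lstep (f \<rho>) l (f' \<rho>)"
        by (rule bexI[where x = "\<lambda>\<rho>. DBang (h' \<rho>)"])
          (use h' f in \<open>auto intro!: pw1I ls_bang\<close>)
    qed
  next
    case (ELet y E N)
    then obtain h g where f: "h \<in> erase (efill E M)" "g \<in> scoped y (erase N)"
        "f = (\<lambda>\<rho>. DLet (h \<rho>) (g \<rho>))"
      by (auto elim: pw2E)
    obtain a where a: "a \<in> erase M" "\<forall>M'. \<forall>a' \<in> erase M'. \<exists>f' \<in> erase (efill E M'). \<forall>\<rho> l.
          (\<forall>x. isval (\<rho> x)) \<longrightarrow> lstep (a \<rho>) l (a' \<rho>) \<longrightarrow> lstep (h \<rho>) l (f' \<rho>)"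
      using ELet.IH[OF _ f(1)] ELet.prems by auto
    show ?case
    proof (intro bexI[OF _ a(1)] allI ballI)
      fix M' a' assume "a' \<in> erase M'"
      then obtain h' where h': "h' \<in> erase (efill E M')" "\<forall>\<rho> l.
          (\<forall>x. isval (\<rho> x)) \<longrightarrow> lstep (a \<rho>) l (a' \<rho>) \<longrightarrow> lstep (h \<rho>) l (h' \<rho>)"
        using a(2) by blast
      show "\<exists>f' \<in> erase (efill (ELet y E N) M'). \<forall>\<rho> l.
          (\<forall>x. isval (\<rho> x)) \<longrightarrow> lstep (a \<rho>) l (a' \<rho>) \<longrightarrow> lstep (f \<rho>) l (f' \<rho>)"
        by (rule bexI[where x = "\<lambda>\<rho>. DLet (h' \<rho>) (g \<rho>)"])
          (use h' f in \<open>auto intro!: pw2I ls_letL\<close>)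
    qed
  qed
  then show thesis using that by blast
qed

text \<open>A read may either consume or keep any item, since \<open>DSt\<close> does not record
  whether the item is volatile.\<close>

inductive mstep :: "db multiset \<Rightarrow> db multiset \<Rightarrow> bool" where
  ms_tau: "lstep t Tau t' \<Longrightarrow> mstep (m + {#t#}) (m + threads t')"
| ms_set: "lstep t (Wr a v) t' \<Longrightarrow> mstep (m + {#t#}) (m + (threads t' + {#DSt a v#}))"
| ms_get: "lstep t (Rd a v) t' \<Longrightarrow> mstep (m + {#t, DSt a v#}) (m + threads t')"
| ms_pget: "lstep t (Rd a v) t' \<Longrightarrow> mstep (m + {#t, DSt a v#}) (m + (threads t' + {#DSt a v#}))"

lemma mstep_add: "mstep m m' \<Longrightarrow> mstep (k + m) (k + m')"
proof (induction rule: mstep.induct)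
  case (ms_tau t t' m)
  then show ?case using mstep.ms_tau[of t t' "k + m"] by (simp add: ac_simps)
next
  case (ms_set t a v t' m)
  then show ?case using mstep.ms_set[of t a v t' "k + m"] by (simp add: ac_simps)
next
  case (ms_get t a v t' m)
  then show ?case using mstep.ms_get[of t a v t' "k + m"] by (simp add: ac_simps)
next
  case (ms_pget t a v t' m)
  then show ?case using mstep.ms_pget[of t a v t' "k + m"] by (simp add: ac_simps)
qed

text \<open>The order of quantifiers matters: \<open>a'\<close> is independent of the environment,
  so the step survives the update \<open>x := DLoc r\<close> made by an enclosing nu.\<close>

definition simulates :: "tm \<Rightarrow> tm \<Rightarrow> bool" where
  "simulates P P' \<longleftrightarrow> (\<forall>a \<in> pool P. \<exists>a' \<in> pool P'. \<forall>\<rho>.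
     (\<forall>x. isval (\<rho> x)) \<longrightarrow> mstep (a \<rho>) (a' \<rho>))"

lemma simulates_sfill: "simulates D D' \<Longrightarrow> simulates (sfill C D) (sfill C D')"
proof (induction C)
  case SHole
  then show ?case by simp
next
  case (SParL C P)
  show ?case
    unfolding simulates_def
  proof
    fix h assume "h \<in> pool (sfill (SParL C P) D)"
    then obtain a b where ab: "a \<in> pool (sfill C D)" "b \<in> pool P" "h = (\<lambda>\<rho>. a \<rho> + b \<rho>)"
      by (auto simp: pool_Par)
    then obtain a' where a': "a' \<in> pool (sfill C D')"
        "\<forall>\<rho>. (\<forall>x. isval (\<rho> x)) \<longrightarrow> mstep (a \<rho>) (a' \<rho>)"
      using SParL unfolding simulates_def by blast
    have mem: "(\<lambda>\<rho>. a' \<rho> + b \<rho>) \<in> pool (sfill (SParL C P) D')"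
      using ab(2) a'(1) by (auto simp: pool_Par)
    have step: "\<forall>\<rho>. (\<forall>x. isval (\<rho> x)) \<longrightarrow> mstep (a \<rho> + b \<rho>) (a' \<rho> + b \<rho>)"
      using a'(2) mstep_add by (metis add.commute)
    show "\<exists>a' \<in> pool (sfill (SParL C P) D').
        \<forall>\<rho>. (\<forall>x. isval (\<rho> x)) \<longrightarrow> mstep (h \<rho>) (a' \<rho>)"
      unfolding ab(3) by (rule bexI[OF _ mem]) (rule step)
  qed
next
  case (SParR P C)
  show ?case
    unfolding simulates_def
  proof
    fix h assume "h \<in> pool (sfill (SParR P C) D)"
    then obtain a b where ab: "a \<in> pool (sfill C D)" "b \<in> pool P" "h = (\<lambda>\<rho>. b \<rho> + a \<rho>)"
      by (auto simp: pool_Par)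
    then obtain a' where a': "a' \<in> pool (sfill C D')"
        "\<forall>\<rho>. (\<forall>x. isval (\<rho> x)) \<longrightarrow> mstep (a \<rho>) (a' \<rho>)"
      using SParR unfolding simulates_def by blast
    have mem: "(\<lambda>\<rho>. b \<rho> + a' \<rho>) \<in> pool (sfill (SParR P C) D')"
      using ab(2) a'(1) by (auto simp: pool_Par)
    have step: "\<forall>\<rho>. (\<forall>x. isval (\<rho> x)) \<longrightarrow> mstep (b \<rho> + a \<rho>) (b \<rho> + a' \<rho>)"
      using a'(2) mstep_add by blast
    show "\<exists>a' \<in> pool (sfill (SParR P C) D').
        \<forall>\<rho>. (\<forall>x. isval (\<rho> x)) \<longrightarrow> mstep (h \<rho>) (a' \<rho>)"
      unfolding ab(3) by (rule bexI[OF _ mem]) (rule step)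
  qed
next
  case (SNu x C)
  show ?case
    unfolding simulates_def
  proof
    fix h assume "h \<in> pool (sfill (SNu x C) D)"
    then obtain a r where a: "a \<in> pool (sfill C D)" "h = (\<lambda>\<rho>. a (\<rho>(x := DLoc r)))"
      unfolding sfill.simps pool_Nu by blast
    then obtain a' where a': "a' \<in> pool (sfill C D')"
        "\<forall>\<rho>. (\<forall>x. isval (\<rho> x)) \<longrightarrow> mstep (a \<rho>) (a' \<rho>)"
      using SNu unfolding simulates_def by blast
    have mem: "(\<lambda>\<rho>. a' (\<rho>(x := DLoc r))) \<in> pool (sfill (SNu x C) D')"
      using a'(1) unfolding sfill.simps pool_Nu by blast
    have step: "\<forall>\<rho>. (\<forall>x. isval (\<rho> x)) \<longrightarrow>
        mstep (a (\<rho>(x := DLoc r))) (a' (\<rho>(x := DLoc r)))"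
      using a'(2) by simp
    show "\<exists>a' \<in> pool (sfill (SNu x C) D').
        \<forall>\<rho>. (\<forall>x. isval (\<rho> x)) \<longrightarrow> mstep (h \<rho>) (a' \<rho>)"
      unfolding a(2) by (rule bexI[OF _ mem]) (rule step)
  qed
qed

text \<open>Only the erasures of \<open>T\<close> and \<open>S\<close> are constrained, so that
  volatile and persistent writes are covered together.\<close>

lemma simulates_set:
  assumes E: "wf_ectx E"
    and T: "erase T = pw2 DSet {\<lambda>\<rho>. \<rho> x} (erase V)"
    and S: "erase S = pw2 DSt {\<lambda>\<rho>. \<rho> x} (erase V)"
  shows "simulates (efill E T) (Par (efill E Unit) S)"
  unfolding simulates_def
proof
  fix h assume "h \<in> pool (efill E T)"
  then obtain f where f: "f \<in> erase (efill E T)" "h = (\<lambda>\<rho>. threads (f \<rho>))"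
    unfolding pool_def by blast
  obtain a where a: "a \<in> erase T"
    and ctx: "\<And>M' a'. a' \<in> erase M' \<Longrightarrow> \<exists>f' \<in> erase (efill E M'). \<forall>\<rho> l.
        (\<forall>x. isval (\<rho> x)) \<longrightarrow> lstep (a \<rho>) l (a' \<rho>) \<longrightarrow> lstep (f \<rho>) l (f' \<rho>)"
    using erase_efill[OF E f(1)] by blast
  obtain v where v: "v \<in> erase V" "a = (\<lambda>\<rho>. DSet (\<rho> x) (v \<rho>))"
    using a unfolding T by (auto elim!: pw_elims)
  have "(\<lambda>\<rho>. DUnit) \<in> erase Unit" by simp
  from ctx[OF this] obtain f' where f': "f' \<in> erase (efill E Unit)"
    and step: "\<forall>\<rho> l. (\<forall>x. isval (\<rho> x)) \<longrightarrow> lstep (a \<rho>) l DUnit \<longrightarrow> lstep (f \<rho>) l (f' \<rho>)"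
    by blast
  have "(\<lambda>\<rho>. DSt (\<rho> x) (v \<rho>)) \<in> erase S"
    using v(1) unfolding S by (auto intro!: pw2I)
  then have mem: "(\<lambda>\<rho>. threads (DPar (f' \<rho>) (DSt (\<rho> x) (v \<rho>)))) \<in> pool (Par (efill E Unit) S)"
    unfolding pool_def erase.simps using f' by (intro imageI pw2I)
  have "mstep (h \<rho>) (threads (DPar (f' \<rho>) (DSt (\<rho> x) (v \<rho>))))" if "\<forall>x. isval (\<rho> x)" for \<rho>
  proof -
    have "lstep (f \<rho>) (Wr (\<rho> x) (v \<rho>)) (f' \<rho>)"
      using step that ls_set by (simp add: v(2))
    then show ?thesis using ms_set[of _ _ _ _ "{#}"] by (simp add: f(2) threads_lstep)
  qed
  then show "\<exists>a' \<in> pool (Par (efill E Unit) S). \<forall>\<rho>. (\<forall>x. isval (\<rho> x)) \<longrightarrow> mstep (h \<rho>) (a' \<rho>)"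
    by (intro bexI[OF _ mem]) blast
qed

text \<open>The rule \<open>ls_get\<close> accepts any result; it is instantiated with the erasure
  \<open>v\<close> of the stored value, so the label matches the item as \<open>mstep\<close>
  requires.\<close>

lemma erase_get:
  assumes E: "wf_ectx E"
    and S: "erase S = pw2 DSt {\<lambda>\<rho>. \<rho> x} (erase W)"
    and h: "h \<in> pool (Par (efill E (Get (Var x))) S)"
  obtains f f' v where "f' \<in> erase (efill E W)" "(\<lambda>\<rho>. DSt (\<rho> x) (v \<rho>)) \<in> erase S"
    and "h = (\<lambda>\<rho>. threads (f \<rho>) + {#DSt (\<rho> x) (v \<rho>)#})"
    and "\<And>\<rho>. \<forall>x. isval (\<rho> x) \<Longrightarrow> lstep (f \<rho>) (Rd (\<rho> x) (v \<rho>)) (f' \<rho>)"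
proof -
  obtain f s where f: "f \<in> erase (efill E (Get (Var x)))" "s \<in> erase S"
      "h = (\<lambda>\<rho>. threads (f \<rho>) + threads (s \<rho>))"
    using h unfolding pool_Par unfolding pool_def by blast
  obtain v where v: "v \<in> erase W" "s = (\<lambda>\<rho>. DSt (\<rho> x) (v \<rho>))"
    using f(2) unfolding S by (auto elim!: pw_elims)
  obtain a where a: "a \<in> erase (Get (Var x))"
    and ctx: "\<And>M' a'. a' \<in> erase M' \<Longrightarrow> \<exists>f' \<in> erase (efill E M'). \<forall>\<rho> l.
        (\<forall>x. isval (\<rho> x)) \<longrightarrow> lstep (a \<rho>) l (a' \<rho>) \<longrightarrow> lstep (f \<rho>) l (f' \<rho>)"
    using erase_efill[OF E f(1)] by blast
  have a_eq: "a = (\<lambda>\<rho>. DGet (\<rho> x))" using a by (auto elim!: pw_elims)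
  from ctx[OF v(1)] obtain f' where f': "f' \<in> erase (efill E W)"
    and step: "\<forall>\<rho> l. (\<forall>x. isval (\<rho> x)) \<longrightarrow> lstep (a \<rho>) l (v \<rho>) \<longrightarrow> lstep (f \<rho>) l (f' \<rho>)"
    by blast
  show thesis
  proof (rule that[OF f'])
    show "(\<lambda>\<rho>. DSt (\<rho> x) (v \<rho>)) \<in> erase S" using f(2) v(2) by simp
    show "h = (\<lambda>\<rho>. threads (f \<rho>) + {#DSt (\<rho> x) (v \<rho>)#})" using f(3) v(2) by simp
    show "lstep (f \<rho>) (Rd (\<rho> x) (v \<rho>)) (f' \<rho>)" if "\<forall>x. isval (\<rho> x)" for \<rho>
      using step that ls_get by (simp add: a_eq)
  qed
qed

lemma simulates_get:
  assumes E: "wf_ectx E" and S: "erase S = pw2 DSt {\<lambda>\<rho>. \<rho> x} (erase W)"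
  shows "simulates (Par (efill E (Get (Var x))) S) (efill E W)"
  unfolding simulates_def
proof
  fix h assume "h \<in> pool (Par (efill E (Get (Var x))) S)"
  from erase_get[OF E S this] obtain f f' v where f': "f' \<in> erase (efill E W)"
    and h: "h = (\<lambda>\<rho>. threads (f \<rho>) + {#DSt (\<rho> x) (v \<rho>)#})"
    and step: "\<And>\<rho>. \<forall>x. isval (\<rho> x) \<Longrightarrow> lstep (f \<rho>) (Rd (\<rho> x) (v \<rho>)) (f' \<rho>)"
    by blast
  have "mstep (h \<rho>) (threads (f' \<rho>))" if "\<forall>x. isval (\<rho> x)" for \<rho>
    using ms_get[OF step[OF that], of "{#}"]
    by (simp add: h threads_lstep[OF step[OF that]] add_mset_commute)
  then show "\<exists>a' \<in> pool (efill E W). \<forall>\<rho>. (\<forall>x. isval (\<rho> x)) \<longrightarrow> mstep (h \<rho>) (a' \<rho>)"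
    by (intro bexI[OF _ poolI[OF f']]) blast
qed

lemma simulates_pget:
  assumes E: "wf_ectx E" and S: "erase S = pw2 DSt {\<lambda>\<rho>. \<rho> x} (erase W)"
  shows "simulates (Par (efill E (Get (Var x))) S) (Par (efill E W) S)"
  unfolding simulates_def
proof
  fix h assume "h \<in> pool (Par (efill E (Get (Var x))) S)"
  from erase_get[OF E S this] obtain f f' v where f': "f' \<in> erase (efill E W)"
    and v: "(\<lambda>\<rho>. DSt (\<rho> x) (v \<rho>)) \<in> erase S"
    and h: "h = (\<lambda>\<rho>. threads (f \<rho>) + {#DSt (\<rho> x) (v \<rho>)#})"
    and step: "\<And>\<rho>. \<forall>x. isval (\<rho> x) \<Longrightarrow> lstep (f \<rho>) (Rd (\<rho> x) (v \<rho>)) (f' \<rho>)"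
    by blast
  have mem: "(\<lambda>\<rho>. threads (DPar (f' \<rho>) (DSt (\<rho> x) (v \<rho>)))) \<in> pool (Par (efill E W) S)"
    unfolding pool_def erase.simps using f' v by (intro imageI pw2I)
  have "mstep (h \<rho>) (threads (DPar (f' \<rho>) (DSt (\<rho> x) (v \<rho>))))" if "\<forall>x. isval (\<rho> x)" for \<rho>
    using ms_pget[OF step[OF that], of "{#}"]
    by (simp add: h threads_lstep[OF step[OF that]] add_mset_commute)
  then show "\<exists>a' \<in> pool (Par (efill E W) S). \<forall>\<rho>. (\<forall>x. isval (\<rho> x)) \<longrightarrow> mstep (h \<rho>) (a' \<rho>)"
    by (intro bexI[OF _ mem]) blast
qed

lemma basic_simulates: "basic D D' \<Longrightarrow> simulates D D'"
proof (induction rule: basic.induct)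
  case (b_beta E M V x)
  show ?case
    unfolding simulates_def
  proof
    fix h assume "h \<in> pool (efill E (App (Lam x M) V))"
    then obtain f where f: "f \<in> erase (efill E (App (Lam x M) V))" "h = (\<lambda>\<rho>. threads (f \<rho>))"
      unfolding pool_def by blast
    obtain a where a: "a \<in> erase (App (Lam x M) V)"
      and ctx: "\<And>M' a'. a' \<in> erase M' \<Longrightarrow> \<exists>f' \<in> erase (efill E M'). \<forall>\<rho> l.
          (\<forall>x. isval (\<rho> x)) \<longrightarrow> lstep (a \<rho>) l (a' \<rho>) \<longrightarrow> lstep (f \<rho>) l (f' \<rho>)"
      using erase_efill[OF b_beta(1) f(1)] by blast
    obtain g v where g: "g \<in> erase M" "v \<in> erase V" "a = (\<lambda>\<rho>. DApp (DLam (g (bind x \<rho>))) (v \<rho>))"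
      using a by (auto elim!: pw_elims)
    obtain f' where f': "f' \<in> erase (efill E (subst V x M))"
      and step: "\<forall>\<rho> l. (\<forall>x. isval (\<rho> x)) \<longrightarrow> lstep (a \<rho>) l (plug x v g \<rho>) \<longrightarrow> lstep (f \<rho>) l (f' \<rho>)"
      using ctx[OF erase_subst[OF g(2,1) b_beta(4)]] by blast
    have "mstep (h \<rho>) (threads (f' \<rho>))" if "\<forall>x. isval (\<rho> x)" for \<rho>
    proof -
      have "lstep (a \<rho>) Tau (plug x v g \<rho>)"
        using erase_isval[OF g(2) b_beta(3)] that ls_beta[of "v \<rho>" "g (bind x \<rho>)"]
        by (simp add: g(3) plug_def inst_erase_bind[OF g(1)])
      then have "lstep (f \<rho>) Tau (f' \<rho>)" using step that by blast
      then show ?thesis using ms_tau[of _ _ "{#}"] by (simp add: f(2) threads_lstep)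
    qed
    then show "\<exists>a' \<in> pool (efill E (subst V x M)). \<forall>\<rho>. (\<forall>x. isval (\<rho> x)) \<longrightarrow> mstep (h \<rho>) (a' \<rho>)"
      by (intro bexI[OF _ poolI[OF f']]) blast
  qed
next
  case (b_let E M V x)
  show ?case
    unfolding simulates_def
  proof
    fix h assume "h \<in> pool (efill E (Let x (Bang V) M))"
    then obtain f where f: "f \<in> erase (efill E (Let x (Bang V) M))" "h = (\<lambda>\<rho>. threads (f \<rho>))"
      unfolding pool_def by blast
    obtain a where a: "a \<in> erase (Let x (Bang V) M)"
      and ctx: "\<And>M' a'. a' \<in> erase M' \<Longrightarrow> \<exists>f' \<in> erase (efill E M'). \<forall>\<rho> l.
          (\<forall>x. isval (\<rho> x)) \<longrightarrow> lstep (a \<rho>) l (a' \<rho>) \<longrightarrow> lstep (f \<rho>) l (f' \<rho>)"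
      using erase_efill[OF b_let(1) f(1)] by blast
    obtain g v where g: "g \<in> erase M" "v \<in> erase V" "a = (\<lambda>\<rho>. DLet (DBang (v \<rho>)) (g (bind x \<rho>)))"
      using a by (auto elim!: pw_elims)
    obtain f' where f': "f' \<in> erase (efill E (subst V x M))"
      and step: "\<forall>\<rho> l. (\<forall>x. isval (\<rho> x)) \<longrightarrow> lstep (a \<rho>) l (plug x v g \<rho>) \<longrightarrow> lstep (f \<rho>) l (f' \<rho>)"
      using ctx[OF erase_subst[OF g(2,1) b_let(4)]] by blast
    have "mstep (h \<rho>) (threads (f' \<rho>))" if "\<forall>x. isval (\<rho> x)" for \<rho>
    proof -
      have "lstep (a \<rho>) Tau (plug x v g \<rho>)"
        using erase_isval[OF g(2) b_let(3)] that ls_let[of "v \<rho>" "g (bind x \<rho>)"]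
        by (simp add: g(3) plug_def inst_erase_bind[OF g(1)])
      then have "lstep (f \<rho>) Tau (f' \<rho>)" using step that by blast
      then show ?thesis using ms_tau[of _ _ "{#}"] by (simp add: f(2) threads_lstep)
    qed
    then show "\<exists>a' \<in> pool (efill E (subst V x M)). \<forall>\<rho>. (\<forall>x. isval (\<rho> x)) \<longrightarrow> mstep (h \<rho>) (a' \<rho>)"
      by (intro bexI[OF _ poolI[OF f']]) blast
  qed
next
  case (b_set E V x)
  then show ?case by (intro simulates_set[where x = x and V = V]) simp_all
next
  case (b_pset E V x)
  then show ?case by (intro simulates_set[where x = x and V = V]) simp_all
next
  case (b_get E V x)
  then show ?case by (intro simulates_get) simp_all
next
  case (b_pget E V x)
  then show ?case by (intro simulates_pget) simp_all
qed

lemma red_simulates: "red P P' \<Longrightarrow> simulates P P'"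
  unfolding red_def using pool_sequiv simulates_sfill[OF basic_simulates]
  by (fastforce simp: simulates_def)

section \<open>Termination\<close>

text \<open>The guard \<open>gd\<close> leaves inaccessible terms without children, which makes the
  relation well-founded on all of \<open>db\<close>. An item emitted by a write counts as a child of
  the writer.\<close>

definition child :: "(reg \<Rightarrow> db set) \<Rightarrow> (db \<times> db) set" where
  "child I = {(s, t). gd I UNIV UNIV t \<and> (\<exists>l t'. lstep t l t' \<and> feeds I l \<and>
     (s \<in># threads t' \<or> (\<exists>a v. l = Wr a v \<and> s = DSt a v)))}"

lemma threads_cases: "threads t = {#t#} \<or> (\<exists>a b. t = DPar a b)"
  by (cases t) auto

lemma threads_gd: "gd I UNIV Q t \<Longrightarrow> s \<in># threads t \<Longrightarrow> gd I UNIV UNIV s"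
proof (induction t arbitrary: Q)
  case (DPar a b)
  then show ?case using gd_Par[OF DPar.prems(1)] by auto
qed (auto intro: gd_mono)

lemma DSt_acc: "DSt a v \<in> Wellfounded.acc (child I)"
  by (rule Wellfounded.accI) (auto simp: child_def elim: lstep_StE)

lemma gd_acc: "gd I UNIV Q t \<Longrightarrow> \<forall>s. s \<in># threads t \<longrightarrow> s \<in> Wellfounded.acc (child I)"
proof (induction rule: gd.induct)
  case (gdI t Q)
  show ?case
  proof (cases "\<exists>a b. t = DPar a b")
    case True
    then obtain a b where "t = DPar a b" by blast
    then show ?thesis using gdI.IH(1,2) by simp
  next
    case False
    have "t \<in> Wellfounded.acc (child I)"
    proof (rule Wellfounded.accI)
      fix s assume "(s, t) \<in> child I"
      then obtain l t' where l: "lstep t l t'" "feeds I l"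
        and s: "s \<in># threads t' \<or> (\<exists>a v. l = Wr a v \<and> s = DSt a v)"
        unfolding child_def by blast
      from s show "s \<in> Wellfounded.acc (child I)"
        using gdI.IH(3)[OF l] DSt_acc by blast
    qed
    then show ?thesis using threads_cases[of t] False by auto
  qed
qed

lemma wf_child: "wf (child I)"
proof (rule acc_wfI, rule allI)
  fix t
  show "t \<in> Wellfounded.acc (child I)"
  proof (rule Wellfounded.accI)
    fix s assume "(s, t) \<in> child I"
    then have "gd I UNIV UNIV t" "t \<in># threads t" and st: "(s, t) \<in> child I"
      unfolding child_def using threads_lstep by fastforce+
    then have "t \<in> Wellfounded.acc (child I)" using gd_acc by blast
    then show "s \<in> Wellfounded.acc (child I)" using st by (rule acc_downward)
  qed
qed

text \<open>Accessible threads and items supply one another: an item holds an element of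
  \<open>I r\<close>, so the reader is fed, and a permitted write emits an accessible item.\<close>

lemma mstep_child:
  assumes "mstep m m'" "\<forall>t. t \<in># m \<longrightarrow> gd I UNIV UNIV t"
  shows "(\<forall>t. t \<in># m' \<longrightarrow> gd I UNIV UNIV t) \<and> (m', m) \<in> mult (child I)"
  using assms
proof (induction rule: mstep.induct)
  case (ms_tau t t' m)
  have t: "gd I UNIV UNIV t" "feeds I Tau" using ms_tau.prems by (auto simp: feeds_def)
  have "gd I UNIV UNIV t'" using gd_step[OF t(1) ms_tau.hyps t(2)] .
  moreover have "(m + threads t', m + {#t#}) \<in> mult (child I)"
    by (rule one_step_implies_mult) (use ms_tau.hyps t in \<open>auto simp: child_def\<close>)
  ultimately show ?case using ms_tau.prems threads_gd by auto
next
  case (ms_set t a v t' m)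
  have t: "gd I UNIV UNIV t" "feeds I (Wr a v)" using ms_set.prems by (auto simp: feeds_def)
  have "gd I UNIV UNIV t'" using gd_step[OF t(1) ms_set.hyps t(2)] .
  moreover have "gd I UNIV UNIV (DSt a v)"
    using gd_permits[OF t(1) ms_set.hyps] by (auto simp: permits_def intro: gd_st)
  moreover have "(m + (threads t' + {#DSt a v#}), m + {#t#}) \<in> mult (child I)"
    by (rule one_step_implies_mult) (use ms_set.hyps t in \<open>auto simp: child_def\<close>)
  ultimately show ?case using ms_set.prems threads_gd by auto
next
  case (ms_get t a v t' m)
  have t: "gd I UNIV UNIV t" "gd I UNIV UNIV (DSt a v)" using ms_get.prems by auto
  have f: "feeds I (Rd a v)" using gd_St[OF t(2)] by (auto simp: feeds_def)
  have "gd I UNIV UNIV t'" using gd_step[OF t(1) ms_get.hyps f] .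
  moreover have "(m + threads t', m + {#t, DSt a v#}) \<in> mult (child I)"
    by (rule one_step_implies_mult) (use ms_get.hyps t f in \<open>auto simp: child_def\<close>)
  ultimately show ?case using ms_get.prems threads_gd by auto
next
  case (ms_pget t a v t' m)
  have t: "gd I UNIV UNIV t" "gd I UNIV UNIV (DSt a v)" using ms_pget.prems by auto
  have f: "feeds I (Rd a v)" using gd_St[OF t(2)] by (auto simp: feeds_def)
  have "gd I UNIV UNIV t'" using gd_step[OF t(1) ms_pget.hyps f] .
  \<comment> \<open>The kept item is moved into the common part, so that only the reader is
    replaced.\<close>
  moreover have "((m + {#DSt a v#}) + threads t', (m + {#DSt a v#}) + {#t#}) \<in> mult (child I)"
    by (rule one_step_implies_mult) (use ms_pget.hyps t f in \<open>auto simp: child_def\<close>)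
  ultimately show ?case using ms_pget.prems threads_gd by (auto simp: add_mset_commute)
qed

lemma ValV_nonempty: "\<exists>v. v \<in> ValV I A"
  by (cases A) auto

lemma env_ex: "\<exists>\<rho>. env I G \<rho>"
proof -
  define \<rho> where
    "\<rho> x = (case G x of None \<Rightarrow> DUnit | Some (u, A) \<Rightarrow> (SOME v. v \<in> ValV I A))" for x
  have "(SOME v. v \<in> ValV I A) \<in> ValV I A" for A
    using ValV_nonempty someI_ex[of "\<lambda>v. v \<in> ValV I A"] by blast
  then have "env I G \<rho>"
    using ValV_isval by (auto simp: env_def \<rho>_def split: option.splits)
  then show ?thesis by blast
qed

theorem mainTheorem8:
  assumes "is_prog P"
    and "typing R \<Gamma> P \<alpha> e"
  shows "terminating P"
proof -
  obtain I where I: "sound I R" using sound_ex[OF typing_distinct[OF assms(2)]] by blast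
  obtain \<rho> where \<rho>: "env I \<Gamma> \<rho>" using env_ex by blast
  then have vals: "\<forall>x. isval (\<rho> x)" by (simp add: env_def)
  obtain f where f: "f \<in> erase P" "gd I UNIV UNIV (f \<rho>)"
    using typing_prog_gd[OF assms(2,1) I] \<rho> by blast
  \<comment> \<open>The position \<open>i\<close> and the erasure \<open>a\<close> are quantified
    inside because they change along the run; \<open>\<rho>\<close> and \<open>I\<close> stay
    fixed.\<close>
  have no_run: "\<forall>i a. a \<in> pool (F i) \<and> m = a \<rho> \<and> (\<forall>t. t \<in># m \<longrightarrow> gd I UNIV UNIV t) \<longrightarrow> False"
    if run: "\<forall>i. red (F i) (F (Suc i))" for F m
  proof (induction m rule: wf_induct_rule[OF wf_mult[OF wf_child[of I]]])
    case (1 m)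
    show ?case
    proof (intro allI impI)
      fix i a assume a: "a \<in> pool (F i) \<and> m = a \<rho> \<and> (\<forall>t. t \<in># m \<longrightarrow> gd I UNIV UNIV t)"
      have "simulates (F i) (F (Suc i))" using run red_simulates by blast
      then obtain a' where "a' \<in> pool (F (Suc i))" "mstep m (a' \<rho>)"
        using a vals unfolding simulates_def by blast
      then show False using 1[of "a' \<rho>"] mstep_child[of m "a' \<rho>" I] a by blast
    qed
  qed
  have "(\<lambda>\<rho>. threads (f \<rho>)) \<in> pool P" using f(1) by (auto simp: pool_def)
  then show ?thesis
    unfolding terminating_def using no_run threads_gd[OF f(2)] by metis
qed

end
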